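(* Suppose that ${\bf a}_0$ is the unique interior lattice point of $\Delta$ (i.e. the unique point of ${\mathbb Z}^n$ in the interior of $\Delta$). Then for every prime number $p\neq 2$ the ratio $\Phi(\lambda)/\Phi(\lambda^p)$, which is an analytic function on ${\mathcal D}$, extends to an analytic function on ${\mathcal D}_+$.
   Context: Let ${\bf a}_0,{\bf a}_1,\dots,{\bf a}_N\in{\mathbb Z}^n$, and let $\hat{\bf a}_j=(1,{\bf a}_j)\in{\mathbb Z}^{n+1}$ for $j=0,\dots,N$. Let $\Delta\subset{\mathbb R}^n$ be the convex hull of $\{{\bf a}_1,\dots,{\bf a}_N\}$. Put $L=\{l=(l_0,\dots,l_N)\in{\mathbb Z}^{N+1}\mid \sum_{j=0}^N l_j\hat{\bf a}_j={\bf 0}\}$ and $L_+=\{l\in L\mid l_i\geq 0 \text{ for } i=1,\dots,N\}$ (for $l\in L$ one has $l_0=-l_1-\cdots-l_N$). Define \[ \Phi(\lambda)=\Phi(\lambda_0,\dots,\lambda_N) = \sum_{l\in L_+} \frac{(-1)^{\sum_{i=1}^N l_i}(l_1+\cdots+l_N)!}{l_1!\cdots l_N!}\prod_{i=1}^N\bigg(\frac{\lambda_i}{\lambda_0}\bigg)^{l_i}, \] a series in $\lambda_1/\lambda_0,\dots,\lambda_N/\lambda_0$ with coefficients in ${\mathbb Z}$. Write $\lambda^p=(\lambda_0^p,\dots,\lambda_N^p)$. Let $p$ be a prime, and let $\Omega$ be the completion of an algebraic closure of ${\mathbb Q}_p$, with its absolute value $|\cdot|$. Define the truncation \[ \Phi_1(\lambda)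 = \sum_{\substack{l\in L_+\\ l_1+\cdots+l_N\leq p-1}} \frac{(-1)^{\sum_{i=1}^N l_i}(l_1+\cdots+l_N)!}{l_1!\cdots l_N!}\prod_{i=1}^N\bigg(\frac{\lambda_i}{\lambda_0}\bigg)^{l_i} \] and the sets (in both, $\lambda_0\neq 0$) \[ {\mathcal D}=\{\lambda\in\Omega^{N+1}\mid |\lambda_i/\lambda_0|<1 \text{ for } i=1,\dots,N\}, \] \[ {\mathcal D}_+=\{\lambda\in\Omega^{N+1}\mid |\lambda_i/\lambda_0|\leq 1 \text{ for } i=1,\dots,N \text{ and } |\Phi_1(\lambda)|=1\}. \] One has ${\mathcal D}\subseteq{\mathcal D}_+$. The series $\Phi$ converges on ${\mathcal D}$ and takes unit values (absolute value $1$) there. An analytic function on ${\mathcal D}_+$ is a function on ${\mathcal D}_+$ that is a uniform limit of a sequence of rational functions (with coefficients in $\Omega$) in the $\lambda_i/\lambda_0$ that are defined on ${\mathcal D}_+$. "Extends" means that there is such a function on ${\mathcal D}_+$ whose restriction to ${\mathcal D}$ equals $\Phi(\lambda)/\Phi(\lambda^p)$. *)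

theory Defs
  imports "HOL-Analysis.Analysis" "HOL-Library.Poly_Mapping"
begin

section \<open>The field \<open>\<Omega>\<close>\<close>

definition algebraic_over :: "'k::field set \<Rightarrow> 'k set" where
  "algebraic_over K = {x. \<exists>q. q \<noteq> 0 \<and> (\<forall>i. coeff q i \<in> K) \<and> poly q x = 0}"

text \<open>
  No single type can be \<open>\<Omega>\<close> for all \<open>p\<close> at once, so \<open>\<Omega>\<close> is described inside an arbitrary type
  \<open>'k\<close> whose metric is \<open>absv (x - y)\<close> for an absolute value \<open>absv\<close>. (The constant \<open>norm\<close> of the
  library is reserved for real normed vector spaces.)
  As \<open>'k\<close> is complete and \<open>absv\<close> extends the \<open>p\<close>-adic absolute value of the integers,
  \<open>closure (range of_rat)\<close> is the field of \<open>p\<close>-adic numbers. Its relative algebraic closure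
  in \<open>'k\<close> is required to be algebraically closed, hence an algebraic closure of it, and to be
  dense in \<open>'k\<close>, so that \<open>'k\<close> is its completion.
\<close>

definition absv :: "'k::{field,metric_space} \<Rightarrow> real" where
  "absv x = dist x 0"

definition Qp_set :: "'k::{field_char_0,metric_space} set" where
  "Qp_set = closure (range of_rat)"

definition is_completed_alg_closure_Qp ::
    "nat \<Rightarrow> 'k::{field_char_0,metric_space} itself \<Rightarrow> bool" where
  "is_completed_alg_closure_Qp p T \<longleftrightarrow>
     (\<forall>x y::'k. dist x y = absv (x - y)) \<and>
     (\<forall>x y::'k. absv (x * y) = absv x * absv y) \<and>
     (\<forall>x y::'k. absv (x + y) \<le> max (absv x) (absv y)) \<and>
     (\<forall>m::int. m \<noteq> 0 \<longrightarrow> absv (of_int m :: 'k) = (1 / real p) ^ multiplicity (int p) m) \<and>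
     complete (UNIV :: 'k set) \<and>
     (\<forall>q::'k poly. degree q > 0 \<and> (\<forall>i. coeff q i \<in> algebraic_over Qp_set) \<longrightarrow>
        (\<exists>x\<in>algebraic_over Qp_set. poly q x = 0)) \<and>
     closure (algebraic_over Qp_set) = (UNIV :: 'k set)"

section \<open>Lattice points\<close>

definition real_vec :: "int ^ 'n \<Rightarrow> real ^ 'n" where
  "real_vec z = (\<chi> i. real_of_int (z $ i))"

definition Delta :: "nat \<Rightarrow> (nat \<Rightarrow> int ^ 'n) \<Rightarrow> (real ^ 'n) set" where
  "Delta N a = convex hull (real_vec ` a ` {1..N})"

text \<open>The index \<^const>\<open>None\<close> carries the additional first coordinate of \<open>(1, z)\<close>.\<close>

definition hat :: "int ^ 'n \<Rightarrow> int ^ ('n option)" where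
  "hat z = (\<chi> i. case i of None \<Rightarrow> 1 | Some k \<Rightarrow> z $ k)"

text \<open>
  Tuples indexed by \<open>0, \<dots>, N\<close> are extensional functions on \<open>{0..N}\<close>, so that each tuple is
  represented exactly once.
\<close>

definition L_lattice :: "nat \<Rightarrow> (nat \<Rightarrow> int ^ 'n) \<Rightarrow> (nat \<Rightarrow> int) set" where
  "L_lattice N a = {l \<in> {0..N} \<rightarrow>\<^sub>E UNIV. (\<Sum>j=0..N. l j *s hat (a j)) = 0}"

definition L_plus :: "nat \<Rightarrow> (nat \<Rightarrow> int ^ 'n) \<Rightarrow> (nat \<Rightarrow> int) set" where
  "L_plus N a = {l \<in> L_lattice N a. \<forall>i\<in>{1..N}. 0 \<le> l i}"

section \<open>The series \<open>\<Phi>\<close> and its truncation\<close>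

definition Phi_term :: "nat \<Rightarrow> (nat \<Rightarrow> int) \<Rightarrow> (nat \<Rightarrow> 'k) \<Rightarrow> 'k::field_char_0" where
  "Phi_term N l lam =
     (-1) powi (\<Sum>i=1..N. l i) * fact (nat (\<Sum>i=1..N. l i)) / (\<Prod>i=1..N. fact (nat (l i)))
       * (\<Prod>i=1..N. (lam i / lam 0) powi l i)"

definition Phi ::
    "nat \<Rightarrow> (nat \<Rightarrow> int ^ 'n) \<Rightarrow> (nat \<Rightarrow> 'k) \<Rightarrow> 'k::{field_char_0,metric_space}" where
  "Phi N a lam = (\<Sum>\<^sub>\<infinity>l\<in>L_plus N a. Phi_term N l lam)"

definition Phi1 :: "nat \<Rightarrow> nat \<Rightarrow> (nat \<Rightarrow> int ^ 'n) \<Rightarrow> (nat \<Rightarrow> 'k) \<Rightarrow> 'k::field_char_0" where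
  "Phi1 p N a lam =
     (\<Sum>l | l \<in> L_plus N a \<and> (\<Sum>i=1..N. l i) \<le> int p - 1. Phi_term N l lam)"

definition pow_tuple :: "nat \<Rightarrow> nat \<Rightarrow> (nat \<Rightarrow> 'k) \<Rightarrow> (nat \<Rightarrow> 'k::field)" where
  "pow_tuple N p lam = (\<lambda>j\<in>{0..N}. lam j ^ p)"

definition D_set :: "nat \<Rightarrow> (nat \<Rightarrow> 'k::{field_char_0,metric_space}) set" where
  "D_set N = {lam \<in> {0..N} \<rightarrow>\<^sub>E UNIV. lam 0 \<noteq> 0 \<and> (\<forall>i\<in>{1..N}. absv (lam i / lam 0) < 1)}"

definition D_plus ::
    "nat \<Rightarrow> nat \<Rightarrow> (nat \<Rightarrow> int ^ 'n) \<Rightarrow> (nat \<Rightarrow> 'k::{field_char_0,metric_space}) set" where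
  "D_plus p N a = {lam \<in> {0..N} \<rightarrow>\<^sub>E UNIV. lam 0 \<noteq> 0 \<and>
     (\<forall>i\<in>{1..N}. absv (lam i / lam 0) \<le> 1) \<and> absv (Phi1 p N a lam) = 1}"

section \<open>Analytic functions\<close>

text \<open>Multivariate polynomials are finitely supported maps from exponent vectors to coefficients.\<close>

definition poly_vars_in :: "nat set \<Rightarrow> ((nat \<Rightarrow>\<^sub>0 nat) \<Rightarrow>\<^sub>0 'k::zero) \<Rightarrow> bool" where
  "poly_vars_in V P \<longleftrightarrow> (\<forall>m\<in>Poly_Mapping.keys P. Poly_Mapping.keys m \<subseteq> V)"

definition poly_eval :: "(nat \<Rightarrow> 'k) \<Rightarrow> ((nat \<Rightarrow>\<^sub>0 nat) \<Rightarrow>\<^sub>0 'k) \<Rightarrow> 'k::field" where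
  "poly_eval x P = (\<Sum>m\<in>Poly_Mapping.keys P. Poly_Mapping.lookup P m *
     (\<Prod>i\<in>Poly_Mapping.keys m. x i ^ Poly_Mapping.lookup m i))"

text \<open>
  Polynomial rings over fields are factorial, so a rational function that is defined at every
  point of \<open>S\<close> is a quotient with a single denominator that vanishes nowhere on \<open>S\<close>.
\<close>

definition rational_on ::
    "nat \<Rightarrow> (nat \<Rightarrow> 'k) set \<Rightarrow> ((nat \<Rightarrow> 'k) \<Rightarrow> 'k::field) \<Rightarrow> bool" where
  "rational_on N S R \<longleftrightarrow> (\<exists>P Q. poly_vars_in {1..N} P \<and> poly_vars_in {1..N} Q \<and>
     (\<forall>lam\<in>S. poly_eval (\<lambda>i. lam i / lam 0) Q \<noteq> 0 \<and>
        R lam = poly_eval (\<lambda>i. lam i / lam 0) P / poly_eval (\<lambda>i. lam i / lam 0) Q))"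

definition analytic_fun_on ::
    "nat \<Rightarrow> (nat \<Rightarrow> 'k) set \<Rightarrow> ((nat \<Rightarrow> 'k) \<Rightarrow> 'k::{field,metric_space}) \<Rightarrow> bool" where
  "analytic_fun_on N S f \<longleftrightarrow>
     (\<exists>R. (\<forall>k. rational_on N S (R k)) \<and> uniform_limit S R f sequentially)"

end

theory Submission
  imports Defs
begin

text \<open>
  Put \<open>x\<^sub>i = \<lambda>\<^sub>i / \<lambda>\<^sub>0\<close>. Give the monomial \<open>y\<^sup>m\<close> in variables \<open>y\<^sub>1, \<dots>, y\<^sub>N\<close> the weight
  \<open>\<Sum> m\<^sub>i (a\<^sub>i - a\<^sub>0)\<close>. By the multinomial theorem \<open>\<Phi>\<close> is the sum over \<open>k\<close> of the weight-zero part of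
  \<open>g\<^sup>k\<close>, where \<open>g = - (y\<^sub>1 + \<dots> + y\<^sub>N)\<close>; taking the weight-zero part is taking the constant term of the
  powers of the Laurent polynomial \<open>- \<Sum> x\<^sub>i X\<^bsup>a\<^sub>i - a\<^sub>0\<^esup>\<close>. Let \<open>\<Phi>\<^sub>s\<close> be the sum over \<open>k < p\<^sup>s\<close> only, a
  polynomial with integer coefficients, and let \<open>\<sigma>\<close> be the Frobenius lift \<open>y\<^sub>i \<mapsto> y\<^sub>i\<^sup>p\<close>. The theorem follows
  from the Dwork congruences
  \<open>\<Phi>\<^bsub>s+1\<^esub> \<cdot> \<sigma> \<Phi>\<^bsub>s-1\<^esub> \<equiv> \<Phi>\<^sub>s \<cdot> \<sigma> \<Phi>\<^sub>s (mod p\<^sup>s)\<close> and \<open>\<Phi>\<^bsub>s+1\<^esub> \<equiv> \<Phi>\<^sub>1 \<cdot> \<sigma> \<Phi>\<^sub>s (mod p)\<close>: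
  by the second, all \<open>\<Phi>\<^sub>s\<close> and \<open>\<sigma> \<Phi>\<^sub>s\<close> take unit values on \<open>\<D>\<^sub>+\<close> since \<open>\<Phi>\<^sub>1\<close> does; by the first, the rational functions
  \<open>\<Phi>\<^bsub>s+1\<^esub> / \<sigma> \<Phi>\<^sub>s\<close> form a uniform Cauchy sequence there; and on \<open>\<D>\<close> they tend to \<open>\<Phi>(\<lambda>) / \<Phi>(\<lambda>\<^sup>p)\<close>.

  The congruences hold because \<open>\<Sum>\<^bsub>k<p^s\<^esub> g\<^sup>k\<close> is the product over \<open>i < s\<close> of \<open>u\<^sub>i = \<Sum>\<^bsub>n<p\<^esub> (g\<^sup>n)\<^bsup>p^i\<^esup>\<close>, and
  \<open>u\<^sub>i \<equiv> \<sigma>\<^sup>k u\<^bsub>i-k\<^esub> (mod p\<^bsup>i-k+1\<^esup>)\<close>. Such a product decomposes into blocks,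
  \<open>\<Prod>\<^bsub>i<s\<^esub> u\<^sub>i = \<Sum>\<^bsub>1\<le>m\<le>s\<^esub> V\<^sub>m \<cdot> \<sigma>\<^sup>m (\<Prod>\<^bsub>i<s-m\<^esub> u\<^sub>i)\<close> with \<open>V\<^sub>m\<close> divisible by \<open>p\<^bsup>m-1\<^esup>\<close> (lemma \<open>dvd_block\<close>).
  The degree of \<open>V\<^sub>m\<close> is less than \<open>p\<^sup>m\<close>, and the interior lattice point is unique; this makes the
  weight-zero part of \<open>V\<^sub>m \<cdot> \<sigma>\<^sup>m W\<close> the product of the weight-zero parts of the two factors (lemma
  \<open>weight_zero_part_mult_frob\<close>). Hence \<open>\<Phi>\<^sub>s = \<Sum> C\<^sub>m \<cdot> \<sigma>\<^sup>m \<Phi>\<^bsub>s-m\<^esub>\<close> with \<open>C\<^sub>m\<close> divisible by \<open>p\<^bsup>m-1\<^esup>\<close>, and an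
  argument of exchanging tails turns this expansion into the Dwork congruences
  (lemma \<open>dvd_cross_difference\<close>).
\<close>

section \<open>Decompositions into blocks\<close>

text \<open>
  Think of \<open>P i j\<close> as the sum over all ways to cut the interval from \<open>i\<close> to \<open>j\<close> into blocks, a block
  from \<open>i\<close> to \<open>k\<close> contributing the factor \<open>c i k\<close>, in which every integer strictly inside the block
  accounts for one factor \<open>w\<close>.
  In \<open>P i j * P i' j'\<close> two cuttings that share a cut point may exchange their tails beyond it, which
  gives the terms of \<open>P i j' * P i' j\<close>. What survives are pairs without a common cut point:
  each of the \<open>j - i' + 1\<close> integers from \<open>i'\<close> to \<open>j\<close> then lies strictly inside a block of one of the
  two cuttings. The induction carries this out by splitting off the first block of the interval that
  starts at the smaller of \<open>i\<close> and \<open>i'\<close>.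
\<close>

lemma dvd_cross_difference:
  fixes P c :: "nat \<Rightarrow> nat \<Rightarrow> 'a::comm_ring_1" and w :: 'a
  assumes blocks: "\<And>i j. i < j \<Longrightarrow> P i j = (\<Sum>k\<in>{i<..j}. c i k * P k j)"
    and dvd: "\<And>i k. i < k \<Longrightarrow> w ^ (k - i - 1) dvd c i k"
    and "i \<le> i'" "i' \<le> j" "j \<le> j'"
  shows "w ^ (j - i' + 1) dvd P i j * P i' j' - P i j' * P i' j"
  using assms(3-5)
proof (induction "2 * j - i - i'" arbitrary: i i' rule: less_induct)
  case less
  show ?case
  proof (cases "i = i'")
    case True
    then show ?thesis by (simp add: mult.commute)
  next
    case False
    with less.prems have ii': "i < i'" by simp
    let ?E = "\<lambda>k. P k j * P i' j' - P k j' * P i' j"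
    have "{i<..j'} = {i<..j} \<union> {j<..j'}" "{i<..j} \<inter> {j<..j'} = {}"
      using less.prems ii' by auto
    then have split: "P i j' = (\<Sum>k\<in>{i<..j}. c i k * P k j') + (\<Sum>k\<in>{j<..j'}. c i k * P k j')"
      using blocks[of i j'] less.prems ii' by (simp add: sum.union_disjoint)
    have "P i j * P i' j' - P i j' * P i' j =
        (\<Sum>k\<in>{i<..j}. c i k * ?E k) - (\<Sum>k\<in>{j<..j'}. c i k * P k j' * P i' j)"
      unfolding split using blocks[of i j] less.prems ii'
      by (simp add: algebra_simps sum_distrib_right sum_distrib_left sum_subtractf)
    moreover have "w ^ (j - i' + 1) dvd c i k * ?E k" if "k \<in> {i<..j}" for k
    proof (cases "k \<le> i'")
      case True
      \<comment> \<open>the divisibility comes from the intervals that remain\<close>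
      then have "w ^ (j - i' + 1) dvd ?E k"
        using less.hyps[of k i'] that less.prems ii' by simp
      then show ?thesis by simp
    next
      case False
      \<comment> \<open>the interval that remains starts after \<open>i'\<close>, so the two intervals exchange their roles\<close>
      then have "w ^ (j - k + 1) dvd P i' j * P k j' - P i' j' * P k j"
        using less.hyps[of i' k] that less.prems ii' by simp
      then have "w ^ (j - k + 1) dvd ?E k"
        using dvd_minus_iff[of "w ^ (j - k + 1)" "?E k"] by (simp add: algebra_simps)
      then have "w ^ ((k - i - 1) + (j - k + 1)) dvd c i k * ?E k"
        unfolding power_add using dvd[of i k] that by (intro mult_dvd_mono) auto
      then show ?thesis
        by (rule power_le_dvd) (use that ii' less.prems in auto)
    qed
    \<comment> \<open>a first block reaching beyond \<open>j\<close> contains all integers from \<open>i'\<close> to \<open>j\<close>\<close>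
    moreover have "w ^ (j - i' + 1) dvd c i k * P k j' * P i' j" if "k \<in> {j<..j'}" for k
    proof -
      have "w ^ (k - i - 1) dvd c i k" using dvd[of i k] that less.prems ii' by simp
      then have "w ^ (j - i' + 1) dvd c i k"
        by (rule power_le_dvd) (use that ii' less.prems in auto)
      then show ?thesis by (simp add: dvd_mult2)
    qed
    ultimately show ?thesis by (auto intro!: dvd_diff dvd_sum)
  qed
qed

text \<open>
  The coefficients \<open>V\<close> that are determined by
  \<open>G s = (\<Sum>m = 1..s. V m * S m (G (s - m)))\<close> when \<open>G 0 = 1\<close> and \<open>S s 1 = 1\<close>, solved for the last one.
  The conditional repeats the range of summation so that the recursion is seen to terminate.
\<close>

fun block :: "(nat \<Rightarrow> 'a \<Rightarrow> 'a) \<Rightarrow> (nat \<Rightarrow> 'a) \<Rightarrow> nat \<Rightarrow> 'a::comm_ring_1" where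
  "block S G s = G s - (\<Sum>m\<in>{1..<s}. if 1 \<le> m \<and> m < s then block S G m * S m (G (s - m)) else 0)"

declare block.simps [simp del]

lemma block_eq: "block S G s = G s - (\<Sum>m\<in>{1..<s}. block S G m * S m (G (s - m)))"
  by (subst block.simps) (auto intro!: sum.cong)

lemma block_expansion:
  assumes "1 \<le> s" "G 0 = 1" "S s 1 = 1"
  shows "G s = (\<Sum>m\<in>{1..s}. block S G m * S m (G (s - m)))"
proof -
  have "{1..s} = insert s {1..<s}" using assms by auto
  then show ?thesis
    using assms block_eq[of S G s] by simp
qed

text \<open>
  Expanding \<open>G (s - 1)\<close> in \<open>G s = u (s - 1) * G (s - 1)\<close> and splitting the last factor off each
  \<open>G (s - m)\<close> in the recursion for \<open>V = block S G\<close> gives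
  \<open>V s = (\<Sum>m = 1..s - 1. V m * (u (s - 1) - S m (u (s - 1 - m))) * S m (G (s - 1 - m)))\<close>.
  The first factor is divisible by \<open>w ^ (m - 1)\<close> by induction, the second by \<open>w ^ (s - m)\<close>.
\<close>

lemma dvd_block:
  fixes S :: "nat \<Rightarrow> 'a \<Rightarrow> 'a::comm_ring_1" and u :: "nat \<Rightarrow> 'a" and w :: 'a
  defines "G \<equiv> \<lambda>s. \<Prod>i<s. u i"
  assumes one: "\<And>k. S k 1 = 1" and mult: "\<And>k a b. S k (a * b) = S k a * S k b"
    and cong: "\<And>i k. k \<le> i \<Longrightarrow> w ^ (i - k + 1) dvd u i - S k (u (i - k))"
    and "1 \<le> s"
  shows "w ^ (s - 1) dvd block S G s"
  using \<open>1 \<le> s\<close>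
proof (induction s rule: less_induct)
  case (less s)
  show ?case
  proof (cases "s = 1")
    case False
    then obtain t where s: "s = Suc t" and t: "1 \<le> t" using less.prems by (cases s) auto
    have G0: "G 0 = 1" and GS: "\<And>n. G (Suc n) = u n * G n" by (auto simp: G_def mult.commute)
    let ?V = "block S G"
    have "?V s = G s - (\<Sum>m\<in>{1..t}. ?V m * S m (G (s - m)))"
      by (subst block_eq) (simp add: s atLeastLessThanSuc_atLeastAtMost)
    also have "G s = (\<Sum>m\<in>{1..t}. u t * (?V m * S m (G (t - m))))"
      unfolding s GS using block_expansion[of t G S, OF t G0 one]
      by (metis (no_types, lifting) sum.cong sum_distrib_left)
    also have "(\<Sum>m\<in>{1..t}. ?V m * S m (G (s - m))) =
        (\<Sum>m\<in>{1..t}. ?V m * (S m (u (t - m)) * S m (G (t - m))))"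
      by (intro sum.cong) (auto simp: s Suc_diff_le GS mult)
    also have "(\<Sum>m\<in>{1..t}. u t * (?V m * S m (G (t - m)))) - \<dots> =
        (\<Sum>m\<in>{1..t}. ?V m * (u t - S m (u (t - m))) * S m (G (t - m)))"
      by (simp add: sum_subtractf[symmetric] algebra_simps)
    finally have *: "?V s = (\<Sum>m\<in>{1..t}. ?V m * (u t - S m (u (t - m))) * S m (G (t - m)))" .
    have "w ^ (s - 1) dvd ?V m * (u t - S m (u (t - m))) * S m (G (t - m))" if "m \<in> {1..t}" for m
    proof -
      have "w ^ ((m - 1) + (t - m + 1)) dvd ?V m * (u t - S m (u (t - m)))"
        unfolding power_add using that s cong[of m t] by (intro mult_dvd_mono less.IH) (auto simp: mult.commute)
      moreover have "(m - 1) + (t - m + 1) = s - 1" using that s by auto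
      ultimately show ?thesis by (metis dvd_mult2)
    qed
    then show ?thesis unfolding * by (intro dvd_sum) auto
  qed simp
qed

text \<open>
  Every \<open>k < p ^ s\<close> has a unique expansion in base \<open>p\<close> with \<open>s\<close> digits.
\<close>

lemma prod_geometric_blocks:
  fixes g :: "'a::comm_ring_1"
  shows "(\<Prod>i<s. \<Sum>n<p. (g ^ n) ^ p ^ i) = (\<Sum>k<p ^ s. g ^ k)"
proof (induction s)
  case (Suc s)
  have "(\<Sum>k<p ^ s. g ^ k) * (\<Sum>n<p. (g ^ n) ^ p ^ s) =
      (\<Sum>n<p. \<Sum>k<p ^ s. g ^ (k + n * p ^ s))"
    by (simp add: sum_product power_add power_mult) (rule sum.swap)
  also have "\<dots> = (\<Sum>n<p. sum ((^) g) {n * p ^ s..<n * p ^ s + p ^ s})"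
    by (rule sum.cong) (auto simp: sum.atLeastLessThan_shift_0 atLeast0LessThan add.commute)
  also have "\<dots> = (\<Sum>k<p ^ Suc s. g ^ k)"
    by (simp add: sum.nat_group)
  finally show ?case using Suc by simp
qed simp


section \<open>Congruences between powers\<close>

lemma prime_dvd_add_power:
  fixes a b :: "'a::comm_ring_1"
  assumes "prime p"
  shows "of_nat p dvd (a + b) ^ p - (a ^ p + b ^ p)"
proof -
  have p: "0 < p" using assms prime_gt_0_nat by auto
  have "{..p} = insert 0 (insert p {1..<p})" using p by auto
  then have "(a + b) ^ p - (a ^ p + b ^ p) =
      (\<Sum>k\<in>{1..<p}. of_nat (p choose k) * a ^ k * b ^ (p - k))"
    unfolding binomial_ring using p by simp
  also have "of_nat p dvd \<dots>"
  proof (rule dvd_sum)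
    fix k assume "k \<in> {1..<p}"
    then have "p dvd (p choose k)" using assms by (auto intro: dvd_choose_prime)
    then obtain c where c: "p choose k = p * c" by blast
    show "of_nat p dvd of_nat (p choose k) * a ^ k * b ^ (p - k)"
      unfolding c by (simp add: mult.assoc)
  qed
  finally show ?thesis .
qed

text \<open>
  In \<open>a ^ p - b ^ p = (a - b) * (\<Sum>k<p. b ^ (p - 1 - k) * a ^ k)\<close> the sum is congruent to
  \<open>p * b ^ (p - 1)\<close> modulo \<open>p\<close>.
\<close>

lemma dvd_power_prime_diff:
  fixes a b :: "'a::comm_ring_1"
  assumes "of_nat p ^ Suc i dvd a - b"
  shows "of_nat p ^ Suc (Suc i) dvd a ^ p - b ^ p"
proof -
  have "of_nat p dvd a - b" using assms by (meson dvd_power dvd_trans zero_less_Suc)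
  have ab: "of_nat p dvd a ^ k - b ^ k" for k
    using \<open>of_nat p dvd a - b\<close> power_diff_sumr2[of a k b] by (simp add: dvd_mult2)
  have "(\<Sum>k<p. b ^ (p - Suc k) * a ^ k) =
      (\<Sum>k<p. b ^ (p - Suc k) * (a ^ k - b ^ k)) + of_nat p * b ^ (p - 1)"
  proof -
    have "(\<Sum>k<p. b ^ (p - Suc k) * b ^ k) = (\<Sum>k<p. b ^ (p - 1))"
      by (intro sum.cong) (auto simp: power_add[symmetric])
    then show ?thesis by (simp add: algebra_simps sum_subtractf)
  qed
  moreover have "of_nat p dvd (\<Sum>k<p. b ^ (p - Suc k) * (a ^ k - b ^ k))"
    by (intro dvd_sum dvd_mult ab)
  ultimately have "of_nat p dvd (\<Sum>k<p. b ^ (p - Suc k) * a ^ k)" by simp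
  then have "of_nat p ^ Suc i * of_nat p dvd (a - b) * (\<Sum>k<p. b ^ (p - Suc k) * a ^ k)"
    using assms by (intro mult_dvd_mono)
  then show ?thesis by (simp add: power_diff_sumr2 mult.commute mult.left_commute)
qed

lemma dvd_prime_power_diff:
  fixes a b :: "'a::comm_ring_1"
  assumes "of_nat p dvd a - b"
  shows "of_nat p ^ Suc i dvd a ^ p ^ i - b ^ p ^ i"
proof (induction i)
  case (Suc i)
  from dvd_power_prime_diff[OF this] show ?case by (simp add: power_mult[symmetric] mult.commute)
qed (use assms in simp)


section \<open>Polynomials with integer coefficients\<close>

type_synonym monomial = "nat \<Rightarrow>\<^sub>0 nat"

text \<open>
  The additive extension of a function on monomials. The Frobenius lift, the weight-zero part and
  the evaluation of a polynomial are all of this form.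
\<close>

definition lin :: "('m \<Rightarrow> 'b) \<Rightarrow> ('m \<Rightarrow>\<^sub>0 int) \<Rightarrow> 'b::comm_ring_1" where
  "lin \<phi> P = (\<Sum>m\<in>Poly_Mapping.keys P. of_int (Poly_Mapping.lookup P m) * \<phi> m)"

lemma lin_zero [simp]: "lin \<phi> 0 = 0"
  by (simp add: lin_def)

lemma lin_single [simp]: "lin \<phi> (Poly_Mapping.single m c) = of_int c * \<phi> m"
  by (cases "c = 0") (simp_all add: lin_def)

lemma lin_add: "lin \<phi> (P + Q) = lin \<phi> P + lin \<phi> Q"
  unfolding lin_def by (rule setsum_keys_plus_distrib) (simp_all add: algebra_simps)

lemma lin_uminus: "lin \<phi> (- P) = - lin \<phi> P"
  using lin_add[of \<phi> P "- P"] by (simp add: eq_neg_iff_add_eq_0 add.commute)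

lemma lin_diff: "lin \<phi> (P - Q) = lin \<phi> P - lin \<phi> Q"
  using lin_add[of \<phi> P "- Q"] by (simp add: lin_uminus)

lemma lin_sum: "lin \<phi> (sum f A) = (\<Sum>i\<in>A. lin \<phi> (f i))"
  by (induction A rule: infinite_finite_induct) (simp_all add: lin_add)

lemma lin_of_nat_mult: "lin \<phi> (of_nat n * P) = of_nat n * lin \<phi> P"
  by (induction n) (simp_all add: algebra_simps lin_add)

lemma lin_of_int_mult: "lin \<phi> (of_int n * P) = of_int n * lin \<phi> P"
  by (cases n rule: int_diff_cases) (auto simp: left_diff_distrib lin_diff lin_of_nat_mult)

lemma sum_singles: "P = (\<Sum>m\<in>Poly_Mapping.keys P. Poly_Mapping.single m (Poly_Mapping.lookup P m))"
  by (rule poly_mapping_eqI)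
     (auto simp: lookup_sum lookup_single when_def in_keys_iff if_distrib sum.delta' cong: if_cong)

lemma lin_mult_keys:
  fixes P Q :: "'m::comm_monoid_add \<Rightarrow>\<^sub>0 int"
  shows "lin \<phi> (P * Q) = (\<Sum>m\<in>Poly_Mapping.keys P. \<Sum>m'\<in>Poly_Mapping.keys Q.
     of_int (Poly_Mapping.lookup P m) * of_int (Poly_Mapping.lookup Q m') * \<phi> (m + m'))"
proof -
  have "P * Q = (\<Sum>m\<in>Poly_Mapping.keys P. \<Sum>m'\<in>Poly_Mapping.keys Q.
     Poly_Mapping.single (m + m') (Poly_Mapping.lookup P m * Poly_Mapping.lookup Q m'))"
    by (subst (1) sum_singles[of P], subst (1) sum_singles[of Q]) (simp only: sum_product mult_single)
  then show ?thesis by (simp add: lin_sum)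
qed

lemma lin_mult:
  fixes P Q :: "'m::comm_monoid_add \<Rightarrow>\<^sub>0 int"
  assumes "\<And>m m'. \<phi> (m + m') = \<phi> m * \<phi> m'"
  shows "lin \<phi> (P * Q) = lin \<phi> P * lin \<phi> Q"
  unfolding lin_mult_keys assms unfolding lin_def sum_product by (simp add: algebra_simps)

lemma lin_lin: "lin \<phi> (lin \<psi> P) = lin (\<lambda>m. lin \<phi> (\<psi> m)) P"
  unfolding lin_def[of \<psi>] lin_sum lin_of_int_mult by (simp add: lin_def)

lemma lin_one: "lin \<phi> (1 :: 'm::comm_monoid_add \<Rightarrow>\<^sub>0 int) = \<phi> 0"
  using lin_single[of \<phi> 0 1] by simp

section \<open>The Frobenius lift\<close>

definition scale :: "nat \<Rightarrow> monomial \<Rightarrow> monomial" where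
  "scale q m = Poly_Mapping.map ((*) q) m"

lemma lookup_scale [simp]: "Poly_Mapping.lookup (scale q m) i = q * Poly_Mapping.lookup m i"
  by (simp add: scale_def Poly_Mapping.map.rep_eq when_def)

lemma scale_add: "scale q (m + m') = scale q m + scale q m'"
  by (rule poly_mapping_eqI) (simp add: lookup_add algebra_simps)

lemma scale_zero [simp]: "scale q 0 = 0"
  by (rule poly_mapping_eqI) simp

lemma scale_scale [simp]: "scale q (scale r m) = scale (q * r) m"
  by (rule poly_mapping_eqI) simp

text \<open>
  The substitution of \<open>y\<^sub>i\<^sup>q\<close> for every variable \<open>y\<^sub>i\<close>.
\<close>

definition frob :: "nat \<Rightarrow> (monomial \<Rightarrow>\<^sub>0 int) \<Rightarrow> (monomial \<Rightarrow>\<^sub>0 int)" where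
  "frob q = lin (\<lambda>m. Poly_Mapping.single (scale q m) 1)"

lemma frob_mult: "frob q (P * Q) = frob q P * frob q Q"
  unfolding frob_def by (rule lin_mult) (simp add: scale_add mult_single)

lemma frob_one [simp]: "frob q 1 = 1"
  by (simp add: frob_def lin_one)

lemma frob_power: "frob q (P ^ n) = frob q P ^ n"
  by (induction n) (simp_all add: frob_mult)

lemma frob_frob: "frob q (frob r P) = frob (q * r) P"
  by (simp add: frob_def lin_lin)

lemma of_int_mult_single_1: "of_int c * Poly_Mapping.single m 1 = Poly_Mapping.single m (c :: int)"
  for m :: monomial
  by (simp add: mult_single flip: single_of_int)

lemma frob_1: "frob 1 P = P"
proof -
  have "scale 1 m = m" for m by (rule poly_mapping_eqI) simp
  then have "frob 1 P = (\<Sum>m\<in>Poly_Mapping.keys P. Poly_Mapping.single m (Poly_Mapping.lookup P m))"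
    unfolding frob_def lin_def by (simp only: of_int_mult_single_1)
  also have "\<dots> = P" by (rule sum_singles[symmetric])
  finally show ?thesis .
qed

lemma single_power: "Poly_Mapping.single m c ^ n = Poly_Mapping.single (scale n m) (c ^ n)"
proof (induction n)
  case 0
  have "scale 0 m = 0" by (rule poly_mapping_eqI) simp
  then show ?case by simp
next
  case (Suc n)
  have "m + scale n m = scale (Suc n) m" by (rule poly_mapping_eqI) (simp add: lookup_add)
  with Suc show ?case by (simp add: mult_single)
qed

text \<open>
  Induction with the binomial congruence proves this for natural numbers, and \<open>c\<close> may be replaced by
  its residue modulo \<open>p\<close>.
\<close>

lemma fermat_int:
  assumes "prime p"
  shows "int p dvd c ^ p - c"
proof -
  have nat: "int p dvd int n ^ p - int n" for n
  proof (induction n)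
    case 0
    then show ?case using prime_gt_0_nat[OF assms] by (simp add: zero_power)
  next
    case (Suc n)
    have "int p dvd (int n + 1) ^ p - (int n ^ p + 1 ^ p)"
      using prime_dvd_add_power[OF assms, of "int n" 1] by simp
    from dvd_add[OF this Suc] show ?case by (simp add: algebra_simps)
  qed
  have "int p dvd (c mod int p) ^ p - c mod int p"
    using nat[of "nat (c mod int p)"] prime_gt_0_nat[OF assms] by simp
  then have "(c mod int p) ^ p mod int p = c mod int p mod int p"
    by (simp only: mod_eq_dvd_iff)
  then have "c ^ p mod int p = c mod int p" by (simp add: power_mod)
  then show ?thesis by (simp only: mod_eq_dvd_iff)
qed

text \<open>
  Modulo \<open>p\<close>, the \<open>p\<close>-th power is additive, maps a monomial to its \<open>p\<close>-th power and fixes the integer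
  coefficients.
\<close>

lemma dvd_frob_diff_power:
  assumes "prime p"
  shows "of_nat p dvd P ^ p - frob p P"
proof -
  have "of_nat p dvd (\<Sum>m\<in>A. Poly_Mapping.single m (f m)) ^ p - frob p (\<Sum>m\<in>A. Poly_Mapping.single m (f m))"
    if "finite A" for A :: "monomial set" and f
    using that
  proof (induction A)
    case empty
    then show ?case using prime_gt_0_nat[OF assms] by (simp add: frob_def zero_power)
  next
    case (insert m A)
    let ?s = "Poly_Mapping.single m (f m)" and ?S = "\<Sum>m\<in>A. Poly_Mapping.single m (f m)"
    obtain c where c: "f m ^ p - f m = int p * c" using fermat_int[OF assms] by blast
    have "?s ^ p - frob p ?s = Poly_Mapping.single (scale p m) (f m ^ p - f m)"
      by (simp add: frob_def single_power single_diff mult_single flip: single_of_int)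
    also have "\<dots> = of_nat p * Poly_Mapping.single (scale p m) c"
      unfolding c by (simp add: mult_single flip: single_of_nat)
    finally have "of_nat p dvd ?s ^ p - frob p ?s" by simp
    from dvd_add[OF dvd_add[OF prime_dvd_add_power[OF assms, of ?s ?S] this] insert.IH]
    show ?case using insert.hyps by (simp add: frob_def lin_add algebra_simps)
  qed
  from this[of "Poly_Mapping.keys P" "Poly_Mapping.lookup P"] show ?thesis
    by (simp flip: sum_singles)
qed

text \<open>
  For \<open>k = 1\<close> this is the congruence \<open>P ^ p \<equiv> frob p P\<close> modulo \<open>p\<close>, raised to the power
  \<open>p ^ (i - 1)\<close>. Applying the Frobenius lift to the statement for \<open>k\<close> and chaining gives \<open>k + 1\<close>; the
  weakest congruence of the chain is the last one, and it determines the exponent.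
\<close>

lemma dvd_power_frob:
  assumes "prime p" "k \<le> i"
  shows "of_nat p ^ (i - k + 1) dvd P ^ p ^ i - frob (p ^ k) (P ^ p ^ (i - k))"
proof -
  have *: "of_nat p ^ (l + 1) dvd P ^ p ^ (l + k) - frob (p ^ k) (P ^ p ^ l)" for l
  proof (induction k)
    case 0
    show ?case using frob_1[of "P ^ p ^ l"] by simp
  next
    case (Suc k)
    have "of_nat p ^ Suc (l + k) dvd (P ^ p) ^ p ^ (l + k) - (frob p P) ^ p ^ (l + k)"
      by (rule dvd_prime_power_diff[OF dvd_frob_diff_power[OF assms(1)]])
    moreover have "(P ^ p) ^ p ^ (l + k) = P ^ p ^ (l + Suc k)"
      by (simp flip: power_mult)
    ultimately have "of_nat p ^ Suc (l + k) dvd P ^ p ^ (l + Suc k) - frob p (P ^ p ^ (l + k))"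
      by (simp only: frob_power)
    then have 1: "of_nat p ^ (l + 1) dvd P ^ p ^ (l + Suc k) - frob p (P ^ p ^ (l + k))"
      by (rule power_le_dvd) simp
    obtain Q where Q: "P ^ p ^ (l + k) - frob (p ^ k) (P ^ p ^ l) = of_nat (p ^ (l + 1)) * Q"
      using Suc unfolding of_nat_power by (elim dvdE)
    have "frob p (P ^ p ^ (l + k)) - frob (p ^ Suc k) (P ^ p ^ l) = of_nat (p ^ (l + 1)) * frob p Q"
      unfolding power_Suc frob_frob[symmetric]
      using arg_cong[OF Q, of "frob p"] by (simp only: frob_def lin_diff lin_of_nat_mult)
    then have "of_nat p ^ (l + 1) dvd frob p (P ^ p ^ (l + k)) - frob (p ^ Suc k) (P ^ p ^ l)"
      by (metis dvd_triv_left of_nat_power)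
    from dvd_add[OF 1 this] show ?case by simp
  qed
  from *[of "i - k"] assms show ?thesis by simp
qed

lemma lin_frob: "lin \<phi> (frob q P) = lin (\<lambda>m. \<phi> (scale q m)) P"
  by (simp add: frob_def lin_lin)

lemma frob_single: "frob q (Poly_Mapping.single m c) = Poly_Mapping.single (scale q m) c"
  by (simp add: frob_def of_int_mult_single_1)

lemma frob_sum: "frob q (sum f A) = (\<Sum>i\<in>A. frob q (f i))"
  by (simp add: frob_def lin_sum)

lemma dvd_frob: "of_nat n dvd P \<Longrightarrow> of_nat n dvd frob q P"
  by (auto simp: dvd_def frob_def lin_of_nat_mult)

section \<open>Weights and the interior lattice point\<close>

definition weight :: "nat \<Rightarrow> (nat \<Rightarrow> int ^ 'n) \<Rightarrow> monomial \<Rightarrow> int ^ 'n" where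
  "weight N a m = (\<Sum>i=1..N. int (Poly_Mapping.lookup m i) *s (a i - a 0))"

definition deg :: "nat \<Rightarrow> monomial \<Rightarrow> nat" where
  "deg N m = (\<Sum>i=1..N. Poly_Mapping.lookup m i)"

lemma weight_component:
  "weight N a m $ k = (\<Sum>i=1..N. int (Poly_Mapping.lookup m i) * (a i $ k - a 0 $ k))"
  by (simp add: weight_def sum_component right_diff_distrib)

lemma weight_add: "weight N a (m + m') = weight N a m + weight N a m'"
  by (simp add: vec_eq_iff weight_component lookup_add distrib_right sum.distrib)

lemma weight_scale: "weight N a (scale q m) = int q *s weight N a m"
  by (simp add: vec_eq_iff weight_component sum_distrib_left mult.assoc)

lemma deg_add: "deg N (m + m') = deg N m + deg N m'"
  by (simp add: deg_def lookup_add sum.distrib)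

lemma deg_scale: "deg N (scale q m) = q * deg N m"
  by (simp add: deg_def sum_distrib_left)

text \<open>
  Dividing the equation \<open>weight N a m = q u\<close> by \<open>q\<close> shows that \<open>a\<^sub>0 + u\<close> is the combination of \<open>a\<^sub>0\<close> and of a
  point \<open>w\<close> of \<open>\<Delta>\<close> with coefficients \<open>1 - d / q > 0\<close> and \<open>d / q\<close>, where \<open>d\<close> is the degree of \<open>m\<close>. As \<open>a\<^sub>0\<close> is
  interior to \<open>\<Delta>\<close>, so is \<open>a\<^sub>0 + u\<close>, and the uniqueness of the interior lattice point forces \<open>u = 0\<close>.
\<close>

lemma weight_eq_0_if_multiple:
  fixes a :: "nat \<Rightarrow> int ^ 'n"
  assumes int: "{z :: int ^ 'n. real_vec z \<in> interior (Delta N a)} = {a 0}"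
    and q: "deg N m < q" and eq: "weight N a m = int q *s u"
  shows "u = 0"
proof (cases "deg N m = 0")
  case True
  then have "weight N a m = 0" by (simp add: deg_def weight_def)
  with eq q show ?thesis by (simp add: vec_eq_iff)
next
  case False
  define d where "d = real (deg N m)"
  define A where "A = (\<lambda>i. real_vec (a i))"
  define c where "c = (\<lambda>i. real (Poly_Mapping.lookup m i) / d)"
  define w where "w = (\<Sum>i=1..N. c i *\<^sub>R A i)"
  have d: "0 < d" using False by (simp add: d_def)
  have csum: "sum c {1..N} = 1"
    using d by (simp add: c_def d_def deg_def flip: sum_divide_distrib)
  have "w \<in> Delta N a"
    unfolding w_def Delta_def
    by (rule convex_sum)
       (use csum d in \<open>auto simp: c_def A_def intro!: hull_inc\<close>)
  moreover have "A 0 \<in> interior (Delta N a)" using int by (auto simp: A_def)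
  ultimately have "w - (1 - d / q) *\<^sub>R (w - A 0) \<in> interior (Delta N a)"
    using q d by (intro mem_interior_convex_shrink) (auto simp: Delta_def d_def)
  moreover have "real_vec (a 0 + u) = w - (1 - d / q) *\<^sub>R (w - A 0)"
  proof (subst vec_eq_iff, rule allI)
    fix k
    have "(\<Sum>i=1..N. int (Poly_Mapping.lookup m i) * (a i $ k - a 0 $ k)) = int q * u $ k"
      using arg_cong[OF eq, of "\<lambda>v. v $ k"] by (simp add: weight_component)
    then have "real_of_int (\<Sum>i=1..N. int (Poly_Mapping.lookup m i) * (a i $ k - a 0 $ k)) = q * u $ k"
      by simp
    then have *: "(\<Sum>i=1..N. real (Poly_Mapping.lookup m i) * (A i $ k - A 0 $ k)) = q * u $ k"
      by (simp add: A_def real_vec_def)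
    have "d * c i = Poly_Mapping.lookup m i" for i using d by (simp add: c_def)
    then have "d * (w $ k) = (\<Sum>i=1..N. real (Poly_Mapping.lookup m i) * (A i $ k))"
      by (simp add: w_def sum_component sum_distrib_left flip: mult.assoc)
    moreover have "d * (A 0 $ k) = (\<Sum>i=1..N. real (Poly_Mapping.lookup m i) * (A 0 $ k))"
      by (simp add: d_def deg_def sum_distrib_right)
    ultimately have "d * (w $ k) - d * (A 0 $ k) =
        (\<Sum>i=1..N. real (Poly_Mapping.lookup m i) * (A i $ k - A 0 $ k))"
      by (simp add: right_diff_distrib sum_subtractf)
    with * have "d * (w $ k - A 0 $ k) = q * u $ k" by (simp add: algebra_simps)
    then have "real_of_int (u $ k) = d / q * (w $ k - A 0 $ k)"
      using q by (simp add: field_simps)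
    then show "real_vec (a 0 + u) $ k = (w - (1 - d / q) *\<^sub>R (w - A 0)) $ k"
      by (simp add: real_vec_def A_def algebra_simps)
  qed
  ultimately have "a 0 + u \<in> {z. real_vec z \<in> interior (Delta N a)}" by simp
  then show ?thesis unfolding int by simp
qed

text \<open>
  In terms of the Laurent polynomial \<open>\<Sum> y\<^sub>i X\<^bsup>a\<^sub>i - a\<^sub>0\<^esup>\<close> this takes the constant term in \<open>X\<close>; the exponent of \<open>X\<close>
  is determined by that of \<open>y\<close>, so that the variables \<open>X\<close> can be left out.
\<close>

definition weight_zero_part :: "nat \<Rightarrow> (nat \<Rightarrow> int ^ 'n) \<Rightarrow> (monomial \<Rightarrow>\<^sub>0 int) \<Rightarrow> (monomial \<Rightarrow>\<^sub>0 int)" where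
  "weight_zero_part N a = lin (\<lambda>m. if weight N a m = 0 then Poly_Mapping.single m 1 else 0)"

lemma weight_zero_part_single: "weight_zero_part N a (Poly_Mapping.single m c) = (if weight N a m = 0 then Poly_Mapping.single m c else 0)"
  by (simp add: weight_zero_part_def of_int_mult_single_1)

lemma weight_zero_part_sum: "weight_zero_part N a (sum f A) = (\<Sum>i\<in>A. weight_zero_part N a (f i))"
  by (simp add: weight_zero_part_def lin_sum)

lemma dvd_weight_zero_part: "of_nat n dvd P \<Longrightarrow> of_nat n dvd weight_zero_part N a P"
  by (auto simp: dvd_def weight_zero_part_def lin_of_nat_mult)

text \<open>
  The weight-zero part is not multiplicative. But if \<open>m\<close> has degree less than \<open>q\<close>, then
  \<open>weight m + q weight m' = 0\<close> makes \<open>weight m\<close> a multiple of \<open>q\<close>, hence zero by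
  \<open>weight_eq_0_if_multiple\<close>, and both weights vanish.
\<close>

lemma weight_zero_part_mult_frob:
  fixes a :: "nat \<Rightarrow> int ^ 'n"
  assumes int: "{z :: int ^ 'n. real_vec z \<in> interior (Delta N a)} = {a 0}"
    and deg: "\<forall>m\<in>Poly_Mapping.keys A. deg N m < q"
  shows "weight_zero_part N a (A * frob q B) = weight_zero_part N a A * frob q (weight_zero_part N a B)"
proof -
  let ?s = "\<lambda>P m. Poly_Mapping.single m (Poly_Mapping.lookup P m) :: monomial \<Rightarrow>\<^sub>0 int"
  have A: "A = (\<Sum>m\<in>Poly_Mapping.keys A. ?s A m)" and B: "B = (\<Sum>m\<in>Poly_Mapping.keys B. ?s B m)"
    by (rule sum_singles)+
  have "weight_zero_part N a (?s A m * frob q (?s B m')) = weight_zero_part N a (?s A m) * frob q (weight_zero_part N a (?s B m'))"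
    if "m \<in> Poly_Mapping.keys A" for m m'
  proof -
    have "weight N a m + int q *s weight N a m' = 0 \<longleftrightarrow> weight N a m = 0 \<and> weight N a m' = 0"
    proof
      assume *: "weight N a m + int q *s weight N a m' = 0"
      then have "weight N a m = int q *s (- weight N a m')"
        by (simp add: add_eq_0_iff2 vec_eq_iff)
      with weight_eq_0_if_multiple[OF int, of m q "- weight N a m'"] deg that
      have "weight N a m' = 0" by simp
      with * show "weight N a m = 0 \<and> weight N a m' = 0" by simp
    qed simp
    then show ?thesis
      by (auto simp: weight_zero_part_single frob_single mult_single weight_add weight_scale)
         (auto simp: frob_def)
  qed
  then show ?thesis
    by (subst A, subst B, subst (3) A, subst (2) B)
       (simp only: frob_sum weight_zero_part_sum sum_product cong: sum.cong)
qed

definition deg_le :: "nat \<Rightarrow> nat \<Rightarrow> (monomial \<Rightarrow>\<^sub>0 int) \<Rightarrow> bool" where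
  "deg_le N d P \<longleftrightarrow> (\<forall>m\<in>Poly_Mapping.keys P. deg N m \<le> d)"

lemma deg_le_mono: "deg_le N d P \<Longrightarrow> d \<le> e \<Longrightarrow> deg_le N e P"
  by (fastforce simp: deg_le_def)

lemma deg_le_uminus: "deg_le N d P \<Longrightarrow> deg_le N d (- P)"
  by (simp add: deg_le_def)

lemma deg_le_diff: "deg_le N d P \<Longrightarrow> deg_le N d Q \<Longrightarrow> deg_le N d (P - Q)"
  using keys_diff[of P Q] by (auto simp: deg_le_def)

lemma deg_le_sum: "(\<And>i. i \<in> A \<Longrightarrow> deg_le N d (f i)) \<Longrightarrow> deg_le N d (sum f A)"
  using keys_sum[of f A] by (fastforce simp: deg_le_def)

lemma deg_le_mult: "deg_le N d P \<Longrightarrow> deg_le N e Q \<Longrightarrow> deg_le N (d + e) (P * Q)"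
  using keys_mult[of P Q] by (fastforce simp: deg_le_def deg_add intro: add_mono)

lemma deg_le_power: "deg_le N 1 P \<Longrightarrow> deg_le N k (P ^ k)"
proof (induction k)
  case 0
  then show ?case by (auto simp: deg_le_def deg_def)
next
  case (Suc k)
  then show ?case using deg_le_mult[of N 1 P k "P ^ k"] by simp
qed

lemma deg_le_frob:
  assumes "deg_le N d P"
  shows "deg_le N (q * d) (frob q P)"
proof -
  have "frob q P = (\<Sum>m\<in>Poly_Mapping.keys P. Poly_Mapping.single (scale q m) (Poly_Mapping.lookup P m))"
    by (simp add: frob_def lin_def of_int_mult_single_1)
  moreover have "deg_le N (q * d) \<dots>"
    using assms by (intro deg_le_sum) (auto simp: deg_le_def deg_scale)
  ultimately show ?thesis by simp
qed

section \<open>The Dwork congruences\<close>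

definition neg_sum_vars :: "nat \<Rightarrow> (monomial \<Rightarrow>\<^sub>0 int)" where
  "neg_sum_vars N = - (\<Sum>i=1..N. Poly_Mapping.single (Poly_Mapping.single i 1) 1)"

lemma deg_le_neg_sum_vars: "deg_le N 1 (neg_sum_vars N)"
  unfolding neg_sum_vars_def
  by (intro deg_le_uminus deg_le_sum) (auto simp: deg_le_def deg_def lookup_single when_def)

text \<open>
  The truncation of \<open>\<Phi>\<close> to total degree less than \<open>p ^ s\<close>, as a polynomial in the \<open>\<lambda>\<^sub>i / \<lambda>\<^sub>0\<close>.
\<close>

definition Phi_trunc :: "nat \<Rightarrow> nat \<Rightarrow> (nat \<Rightarrow> int ^ 'n) \<Rightarrow> nat \<Rightarrow> (monomial \<Rightarrow>\<^sub>0 int)" where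
  "Phi_trunc p N a s = weight_zero_part N a (\<Sum>k<p ^ s. neg_sum_vars N ^ k)"

text \<open>
  The block decomposition of \<open>\<Sum>\<^bsub>k<p^s\<^esub> g\<^sup>k\<close>, seen in weight zero. The block \<open>V m\<close> has degree less than \<open>p ^ m\<close>,
  so that taking the weight-zero part respects the products in the decomposition.
\<close>

lemma Phi_trunc_expansion:
  fixes a :: "nat \<Rightarrow> int ^ 'n"
  assumes int: "{z :: int ^ 'n. real_vec z \<in> interior (Delta N a)} = {a 0}" and p: "prime p"
  shows "\<exists>C. (\<forall>s\<ge>1. Phi_trunc p N a s = (\<Sum>m\<in>{1..s}. C m * frob (p ^ m) (Phi_trunc p N a (s - m)))) \<and>
    (\<forall>m\<ge>1. of_nat p ^ (m - 1) dvd C m) \<and> C 1 = Phi_trunc p N a 1"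
proof -
  \<comment> \<open>one factor for each digit in the base-\<open>p\<close> expansion of the exponent\<close>
  define u where "u = (\<lambda>i. \<Sum>n<p. (neg_sum_vars N ^ n) ^ p ^ i)"
  define G where "G = (\<lambda>s. \<Prod>i<s. u i)"
  define S where "S = (\<lambda>k. frob (p ^ k))"
  define V where "V = block S G"
  have G: "G s = (\<Sum>k<p ^ s. neg_sum_vars N ^ k)" for s
    unfolding G_def u_def by (rule prod_geometric_blocks)
  have p0: "0 < p" using prime_gt_0_nat[OF p] .
  have dvdV: "of_nat p ^ (m - 1) dvd V m" if "1 \<le> m" for m
    unfolding V_def G_def
  proof (rule dvd_block)
    fix i k :: nat assume "k \<le> i"
    then show "of_nat p ^ (i - k + 1) dvd u i - S k (u (i - k))"
      unfolding u_def S_def frob_sum sum_subtractf[symmetric]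
      by (intro dvd_sum dvd_power_frob p)
  qed (use that in \<open>simp_all add: S_def frob_mult\<close>)
  have degG: "deg_le N (p ^ s - 1) (G s)" for s
    unfolding G by (intro deg_le_sum deg_le_mono[OF deg_le_power[OF deg_le_neg_sum_vars]]) auto
  have degV: "deg_le N (p ^ s - 1) (V s)" for s
  proof (induction s rule: less_induct)
    case (less s)
    have "deg_le N (p ^ s - 1) (V m * S m (G (s - m)))" if "m \<in> {1..<s}" for m
    proof (rule deg_le_mono)
      show "deg_le N ((p ^ m - 1) + p ^ m * (p ^ (s - m) - 1)) (V m * S m (G (s - m)))"
        unfolding S_def using that by (intro deg_le_mult deg_le_frob less.IH degG) auto
      have "p ^ m * p ^ (s - m) = p ^ s" using that by (simp flip: power_add)
      moreover have "1 \<le> p ^ m" "p ^ m \<le> p ^ s" using p0 that by (simp_all add: power_increasing)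
      ultimately show "(p ^ m - 1) + p ^ m * (p ^ (s - m) - 1) \<le> p ^ s - 1"
        by (simp add: diff_mult_distrib2)
    qed
    then show ?case unfolding V_def[symmetric] unfolding V_def[THEN fun_cong] block_eq[of S G s]
      unfolding V_def[symmetric] by (intro deg_le_diff degG deg_le_sum)
  qed
  have exp: "G s = (\<Sum>m\<in>{1..s}. V m * S m (G (s - m)))" if "1 \<le> s" for s
    unfolding V_def by (rule block_expansion) (use that in \<open>auto simp: G_def S_def\<close>)
  show ?thesis
  proof (intro exI[of _ "\<lambda>m. weight_zero_part N a (V m)"] conjI allI impI)
    fix s :: nat assume "1 \<le> s"
    have "weight_zero_part N a (V m * frob (p ^ m) (G (s - m))) =
        weight_zero_part N a (V m) * frob (p ^ m) (weight_zero_part N a (G (s - m)))" for m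
      using degV[of m] p0
      by (intro weight_zero_part_mult_frob[OF int]) (force simp: deg_le_def dest: le_imp_less_Suc)
    then show "Phi_trunc p N a s =
        (\<Sum>m = 1..s. weight_zero_part N a (V m) * frob (p ^ m) (Phi_trunc p N a (s - m)))"
      unfolding Phi_trunc_def G[symmetric] by (subst exp[OF \<open>1 \<le> s\<close>]) (simp add: weight_zero_part_sum S_def)
  next
    fix m :: nat assume "1 \<le> m"
    show "of_nat p ^ (m - 1) dvd weight_zero_part N a (V m)"
      using dvd_weight_zero_part[of "p ^ (m - 1)"] dvdV[OF \<open>1 \<le> m\<close>] by simp
  next
    show "weight_zero_part N a (V 1) = Phi_trunc p N a 1"
      unfolding Phi_trunc_def G[symmetric] V_def block_eq[of S G 1] by simp
  qed
qed

text \<open>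
  The polynomials \<open>\<sigma>\<^sup>i \<Phi>\<^bsub>j-i\<^esub>\<close> satisfy the hypotheses of \<open>dvd_cross_difference\<close>; the congruence compares
  the intervals from \<open>0\<close> to \<open>s\<close> and from \<open>1\<close> to \<open>s + 1\<close>.
\<close>

theorem dwork_congruence:
  fixes a :: "nat \<Rightarrow> int ^ 'n"
  assumes int: "{z :: int ^ 'n. real_vec z \<in> interior (Delta N a)} = {a 0}" and p: "prime p"
    and s: "1 \<le> s"
  shows "of_nat p ^ s dvd Phi_trunc p N a s * frob p (Phi_trunc p N a s)
    - Phi_trunc p N a (Suc s) * frob p (Phi_trunc p N a (s - 1))"
proof -
  obtain C where C: "\<And>s. 1 \<le> s \<Longrightarrow> Phi_trunc p N a s = (\<Sum>m\<in>{1..s}. C m * frob (p ^ m) (Phi_trunc p N a (s - m)))"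
    "\<And>m. 1 \<le> m \<Longrightarrow> of_nat p ^ (m - 1) dvd C m" "C 1 = Phi_trunc p N a 1"
    using Phi_trunc_expansion[OF int p] by blast
  define P where "P = (\<lambda>i j. frob (p ^ i) (Phi_trunc p N a (j - i)))"
  define c where "c = (\<lambda>i k. frob (p ^ i) (C (k - i)))"
  have "of_nat p ^ (s - 1 + 1) dvd P 0 s * P 1 (Suc s) - P 0 (Suc s) * P 1 s"
  proof (rule dvd_cross_difference)
    fix i j :: nat assume "i < j"
    then have "P i j = (\<Sum>m\<in>{1..j - i}. frob (p ^ i) (C m) * frob (p ^ (i + m)) (Phi_trunc p N a (j - i - m)))"
      unfolding P_def by (subst C(1)) (simp_all add: frob_sum frob_mult frob_frob power_add)
    also have "\<dots> = (\<Sum>k\<in>{i<..j}. c i k * P k j)"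
      by (rule sum.reindex_bij_witness[of _ "\<lambda>k. k - i" "\<lambda>m. i + m"]) (auto simp: c_def P_def)
    finally show "P i j = (\<Sum>k\<in>{i<..j}. c i k * P k j)" .
  next
    fix i k :: nat assume "i < k"
    then show "of_nat p ^ (k - i - 1) dvd c i k"
      unfolding c_def using C(2)[of "k - i"] dvd_frob[of "p ^ (k - i - 1)"] by simp
  qed (use s in auto)
  moreover have "frob (p ^ 0) Q = Q" for Q using frob_1[of Q] by simp
  ultimately show ?thesis using s by (simp add: P_def)
qed

text \<open>
  Modulo \<open>p\<close> only the first term of \<open>Phi_trunc_expansion\<close> is left.
\<close>

lemma Phi_trunc_cong_first:
  fixes a :: "nat \<Rightarrow> int ^ 'n"
  assumes int: "{z :: int ^ 'n. real_vec z \<in> interior (Delta N a)} = {a 0}" and p: "prime p"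
  shows "of_nat p dvd Phi_trunc p N a (Suc s) - Phi_trunc p N a 1 * frob p (Phi_trunc p N a s)"
proof -
  obtain C where C: "\<And>s. 1 \<le> s \<Longrightarrow> Phi_trunc p N a s = (\<Sum>m\<in>{1..s}. C m * frob (p ^ m) (Phi_trunc p N a (s - m)))"
    "\<And>m. 1 \<le> m \<Longrightarrow> of_nat p ^ (m - 1) dvd C m" "C 1 = Phi_trunc p N a 1"
    using Phi_trunc_expansion[OF int p] by blast
  have "{1..Suc s} = insert 1 {2..Suc s}" by auto
  then have "Phi_trunc p N a (Suc s) - Phi_trunc p N a 1 * frob p (Phi_trunc p N a s) =
      (\<Sum>m\<in>{2..Suc s}. C m * frob (p ^ m) (Phi_trunc p N a (Suc s - m)))"
    by (subst C(1)) (simp_all add: C(3)[simplified])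
  also have "of_nat p dvd \<dots>"
  proof (intro dvd_sum dvd_mult2)
    fix m assume "m \<in> {2..Suc s}"
    then have "of_nat p ^ 1 dvd C m" by (intro power_le_dvd[OF C(2)]) auto
    then show "of_nat p dvd C m" by simp
  qed
  finally show ?thesis .
qed

section \<open>The multinomial theorem\<close>

definition multinomial :: "'i set \<Rightarrow> ('i \<Rightarrow> nat) \<Rightarrow> nat" where
  "multinomial I m = fact (sum m I) div (\<Prod>i\<in>I. fact (m i))"

text \<open>
  The division in the definition of \<open>multinomial\<close> is exact.
\<close>

lemma prod_fact_mult_multinomial:
  assumes "finite I"
  shows "(\<Prod>i\<in>I. fact (m i)) * multinomial I m = fact (sum m I)"
proof -
  have "(\<Prod>i\<in>I. fact (m i) :: nat) dvd fact (sum m I)"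
    using assms
  proof (induction I)
    case (insert x I)
    then show ?case
      using dvd_trans[OF mult_dvd_mono[OF dvd_refl insert.IH]
          fact_fact_dvd_fact[of "m x" "sum m I", where 'a = nat]]
      by simp
  qed simp
  then show ?thesis by (simp add: multinomial_def)
qed

lemma of_nat_multinomial:
  assumes "finite I"
  shows "(of_nat (multinomial I m) :: 'a::field_char_0) = fact (sum m I) / (\<Prod>i\<in>I. fact (m i))"
proof -
  have "(\<Prod>i\<in>I. fact (m i)) * of_nat (multinomial I m) = (fact (sum m I) :: 'a)"
    using arg_cong[OF prod_fact_mult_multinomial[OF assms, of m], of "of_nat :: nat \<Rightarrow> 'a"] by simp
  moreover have "(\<Prod>i\<in>I. fact (m i)) \<noteq> (0 :: 'a)"
    using assms by simp
  ultimately show ?thesis by (simp add: field_simps)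
qed

lemma multinomial_cong: "(\<And>i. i \<in> I \<Longrightarrow> m i = m' i) \<Longrightarrow> multinomial I m = multinomial I m'"
  by (simp add: multinomial_def cong: sum.cong_simp prod.cong_simp)

lemma multinomial_insert:
  assumes "finite I" "x \<notin> I"
  shows "multinomial (insert x I) m = (sum m (insert x I) choose m x) * multinomial I m"
proof -
  let ?k = "sum m (insert x I)"
  have "(\<Prod>i\<in>insert x I. fact (m i)) * multinomial (insert x I) m = fact ?k"
    using assms by (intro prod_fact_mult_multinomial) simp
  also have "\<dots> = fact (m x) * fact (sum m I) * (?k choose m x)"
    using binomial_fact_lemma[of "m x" ?k] assms by simp
  also have "\<dots> = (\<Prod>i\<in>insert x I. fact (m i)) * ((?k choose m x) * multinomial I m)"
    using assms by (simp flip: prod_fact_mult_multinomial[OF assms(1), of m])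
  finally show ?thesis using assms by simp
qed

definition multi_indices :: "'i set \<Rightarrow> nat \<Rightarrow> ('i \<Rightarrow> nat) set" where
  "multi_indices I k = {m \<in> I \<rightarrow>\<^sub>E UNIV. sum m I = k}"

lemma finite_multi_indices:
  assumes "finite I"
  shows "finite (multi_indices I k)"
proof (rule finite_subset)
  show "multi_indices I k \<subseteq> I \<rightarrow>\<^sub>E {..k}"
  proof
    fix m assume m: "m \<in> multi_indices I k"
    have "m i \<le> k" if "i \<in> I" for i
      using member_le_sum[of i I m] that m assms by (simp add: multi_indices_def)
    with m show "m \<in> I \<rightarrow>\<^sub>E {..k}" by (simp add: multi_indices_def PiE_iff)
  qed
qed (use assms in \<open>auto intro: finite_PiE\<close>)

lemma multinomial_theorem:
  fixes y :: "'i \<Rightarrow> 'a::comm_ring_1"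
  assumes "finite I"
  shows "(\<Sum>i\<in>I. y i) ^ k =
    (\<Sum>m\<in>multi_indices I k. of_nat (multinomial I m) * (\<Prod>i\<in>I. y i ^ m i))"
  using assms
proof (induction I arbitrary: k)
  case empty
  have "multi_indices {} k = (if k = 0 then {\<lambda>i. undefined} else {} :: ('i \<Rightarrow> nat) set)"
    by (auto simp: multi_indices_def)
  then show ?case by (simp add: multinomial_def zero_power)
next
  case (insert x I)
  let ?t = "\<lambda>I m. of_nat (multinomial I m) * (\<Prod>i\<in>I. y i ^ m i)"
  have "(\<Sum>i\<in>insert x I. y i) ^ k =
      (\<Sum>j\<le>k. of_nat (k choose j) * y x ^ j * (\<Sum>i\<in>I. y i) ^ (k - j))"
    using insert.hyps by (simp add: binomial_ring)
  also have "\<dots> = (\<Sum>j\<le>k. \<Sum>m\<in>multi_indices I (k - j). of_nat (k choose j) * y x ^ j * ?t I m)"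
    unfolding insert.IH by (simp add: sum_distrib_left)
  also have "\<dots> = (\<Sum>(j, m)\<in>(SIGMA j:{..k}. multi_indices I (k - j)). of_nat (k choose j) * y x ^ j * ?t I m)"
    by (rule sum.Sigma) (auto intro: finite_multi_indices insert.hyps)
  also have "\<dots> = (\<Sum>m\<in>multi_indices (insert x I) k. ?t (insert x I) m)"
  proof (rule sum.reindex_bij_witness[of _ "\<lambda>m. (m x, m(x := undefined))" "\<lambda>(j, m). m(x := j)"])
    fix jm assume jm: "jm \<in> (SIGMA j:{..k}. multi_indices I (k - j))"
    obtain j m where [simp]: "jm = (j, m)" by (cases jm)
    from jm have j: "j \<le> k" and m: "m \<in> I \<rightarrow>\<^sub>E UNIV" "sum m I = k - j"
      by (auto simp: multi_indices_def)
    have s: "sum (m(x := j)) I = sum m I" 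
      using insert.hyps by (intro sum.cong) auto
    show "(case jm of (j, m) \<Rightarrow> m(x := j)) \<in> multi_indices (insert x I) k"
      using insert.hyps m j s by (auto simp: multi_indices_def PiE_iff extensional_def)
    show "((case jm of (j, m) \<Rightarrow> m(x := j)) x, (case jm of (j, m) \<Rightarrow> m(x := j))(x := undefined)) = jm"
      using insert.hyps m by (auto simp: PiE_iff extensional_def)
    have "multinomial I (m(x := j)) = multinomial I m"
      using insert.hyps by (intro multinomial_cong) auto
    moreover have "(\<Prod>i\<in>I. y i ^ (m(x := j)) i) = (\<Prod>i\<in>I. y i ^ m i)"
      using insert.hyps by (intro prod.cong) auto
    ultimately show "?t (insert x I) (case jm of (j, m) \<Rightarrow> m(x := j)) =
        (case jm of (j, m) \<Rightarrow> of_nat (k choose j) * y x ^ j * ?t I m)"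
      using insert.hyps m j s by (simp add: multinomial_insert mult_ac)
  next
    fix m assume m: "m \<in> multi_indices (insert x I) k"
    have "sum (m(x := undefined)) I = sum m I"
      using insert.hyps by (intro sum.cong) auto
    then show "(m x, m(x := undefined)) \<in> (SIGMA j:{..k}. multi_indices I (k - j))"
      using m insert.hyps by (auto simp: multi_indices_def PiE_iff extensional_def)
    show "(case (m x, m(x := undefined)) of (j, m) \<Rightarrow> m(x := j)) = m" by simp
  qed
  finally show ?case .
qed

section \<open>Truncations of \<open>\<Phi>\<close> as values of polynomials\<close>

definition ev :: "nat \<Rightarrow> (nat \<Rightarrow> 'k) \<Rightarrow> (monomial \<Rightarrow>\<^sub>0 int) \<Rightarrow> 'k::comm_ring_1" where
  "ev N x = lin (\<lambda>m. \<Prod>i=1..N. x i ^ Poly_Mapping.lookup m i)"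

lemma ev_mult: "ev N x (P * Q) = ev N x P * ev N x Q"
  unfolding ev_def by (rule lin_mult) (simp add: lookup_add power_add prod.distrib)

lemma ev_diff: "ev N x (P - Q) = ev N x P - ev N x Q"
  by (simp add: ev_def lin_diff)

lemma ev_one: "ev N x 1 = 1"
  by (simp add: ev_def lin_one)

lemma ev_power: "ev N x (P ^ n) = ev N x P ^ n"
  by (induction n) (simp_all add: ev_one ev_mult)

lemma ev_of_nat_mult: "ev N x (of_nat n * P) = of_nat n * ev N x P"
  by (simp add: ev_def lin_of_nat_mult)

lemma ev_frob: "ev N x (frob q P) = ev N (\<lambda>i. x i ^ q) P"
  by (simp add: ev_def lin_frob power_mult)

lemma ev_cong: "(\<And>i. i \<in> {1..N} \<Longrightarrow> x i = y i) \<Longrightarrow> ev N x P = ev N y P"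
  unfolding ev_def by (intro arg_cong2[where f = lin] ext prod.cong) auto

definition exponents :: "nat \<Rightarrow> (nat \<Rightarrow> nat) \<Rightarrow> monomial" where
  "exponents N m = (\<Sum>i=1..N. Poly_Mapping.single i (m i))"

lemma lookup_exponents: "Poly_Mapping.lookup (exponents N m) i = (if i \<in> {1..N} then m i else 0)"
  by (simp add: exponents_def lookup_sum lookup_single when_def)

lemma scale_single: "scale n (Poly_Mapping.single i j) = Poly_Mapping.single i (n * j)"
  by (rule poly_mapping_eqI) (simp add: lookup_single when_def)

lemma prod_singles: "(\<Prod>i\<in>A. Poly_Mapping.single (f i :: monomial) (1::int)) = Poly_Mapping.single (sum f A) 1"
  by (induction A rule: infinite_finite_induct) (simp_all add: mult_single)

lemma single_exponents:
  "Poly_Mapping.single (exponents N m) (1 :: int) =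
    (\<Prod>i=1..N. Poly_Mapping.single (Poly_Mapping.single i 1) 1 ^ m i)"
  unfolding single_power scale_single exponents_def prod_singles[symmetric] by simp

lemma neg_sum_vars_power:
  "neg_sum_vars N ^ k = (\<Sum>m\<in>multi_indices {1..N} k.
     Poly_Mapping.single (exponents N m) ((-1) ^ k * int (multinomial {1..N} m)))"
proof -
  have "neg_sum_vars N ^ k = (- 1) ^ k * (\<Sum>i=1..N. Poly_Mapping.single (Poly_Mapping.single i 1) 1) ^ k"
    unfolding neg_sum_vars_def by (rule power_minus)
  also have "(\<Sum>i=1..N. Poly_Mapping.single (Poly_Mapping.single i 1) 1 :: monomial \<Rightarrow>\<^sub>0 int) ^ k =
      (\<Sum>m\<in>multi_indices {1..N} k.
        of_nat (multinomial {1..N} m) * Poly_Mapping.single (exponents N m) 1)"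
    unfolding single_exponents by (rule multinomial_theorem) simp
  also have "(- 1) ^ k * \<dots> = (\<Sum>m\<in>multi_indices {1..N} k. (- 1) ^ k *
      (of_nat (multinomial {1..N} m) * Poly_Mapping.single (exponents N m) 1))"
    by (rule sum_distrib_left)
  also have "\<dots> = (\<Sum>m\<in>multi_indices {1..N} k.
     Poly_Mapping.single (exponents N m) ((-1) ^ k * int (multinomial {1..N} m)))"
  proof (rule sum.cong[OF refl])
    fix m
    let ?s = "Poly_Mapping.single (exponents N m) (1 :: int)"
    have "(- 1) ^ k * (of_nat (multinomial {1..N} m) * ?s) =
      of_int ((-1) ^ k * int (multinomial {1..N} m)) * ?s"
      by (simp only: of_int_mult of_int_power of_int_minus of_int_1 of_int_of_nat_eq mult.assoc)
    also have "\<dots> = Poly_Mapping.single (exponents N m) ((-1) ^ k * int (multinomial {1..N} m))"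
      by (rule of_int_mult_single_1)
    finally show "(- 1) ^ k * (of_nat (multinomial {1..N} m) * ?s) =
        Poly_Mapping.single (exponents N m) ((-1) ^ k * int (multinomial {1..N} m))" .
  qed
  finally show ?thesis .
qed

text \<open>
  The additional first coordinate of the relation that defines \<open>L\<close> determines \<open>l\<^sub>0\<close>, and the others say
  that \<open>(l\<^sub>1, \<dots>, l\<^sub>N)\<close> has weight zero.
\<close>

lemma L_plus_iff:
  fixes a :: "nat \<Rightarrow> int ^ 'n"
  shows "l \<in> L_plus N a \<longleftrightarrow> l \<in> {0..N} \<rightarrow>\<^sub>E UNIV \<and> (\<forall>i\<in>{1..N}. 0 \<le> l i) \<and>
    l 0 = - (\<Sum>i=1..N. l i) \<and> weight N a (exponents N (\<lambda>i. nat (l i))) = 0"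
proof -
  have split: "(\<Sum>j=0..N. f j) = f 0 + (\<Sum>j=1..N. f j)" for f :: "nat \<Rightarrow> int"
    by (simp add: sum.atLeast_Suc_atMost)
  have "(\<Sum>j=0..N. l j *s hat (a j)) = 0 \<longleftrightarrow>
      (\<forall>k. (\<Sum>j=0..N. l j * hat (a j) $ k) = 0)"
    by (simp add: vec_eq_iff sum_component)
  also have "\<dots> \<longleftrightarrow> (\<Sum>j=0..N. l j) = 0 \<and> (\<forall>k. (\<Sum>j=0..N. l j * a j $ k) = 0)"
    by (subst split_option_all) (simp add: hat_def)
  also have "\<dots> \<longleftrightarrow> l 0 = - (\<Sum>i=1..N. l i) \<and> (\<forall>k. (\<Sum>i=1..N. l i * (a i $ k - a 0 $ k)) = 0)"
  proof -
    define S where "S = (\<Sum>i=1..N. l i)"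
    define T where "T = (\<lambda>k. \<Sum>i=1..N. l i * a i $ k)"
    have "(\<Sum>i=1..N. l i * (a i $ k - a 0 $ k)) = T k - S * a 0 $ k" for k
      unfolding S_def T_def by (simp only: right_diff_distrib sum_subtractf sum_distrib_right)
    moreover have "l 0 + S = 0 \<and> (\<forall>k. l 0 * a 0 $ k + T k = 0) \<longleftrightarrow>
        l 0 = - S \<and> (\<forall>k. T k - S * a 0 $ k = 0)"
    proof (rule conj_cong)
      show "l 0 + S = 0 \<longleftrightarrow> l 0 = - S" by linarith
      assume "l 0 = - S"
      then have "l 0 * a 0 $ k + T k = T k - S * a 0 $ k" for k by simp
      then show "(\<forall>k. l 0 * a 0 $ k + T k = 0) \<longleftrightarrow> (\<forall>k. T k - S * a 0 $ k = 0)"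
        by (simp only:)
    qed
    ultimately show ?thesis unfolding split by (simp only: S_def T_def)
  qed
  finally have *: "(\<Sum>j=0..N. l j *s hat (a j)) = 0 \<longleftrightarrow>
      l 0 = - (\<Sum>i=1..N. l i) \<and> (\<forall>k. (\<Sum>i=1..N. l i * (a i $ k - a 0 $ k)) = 0)" .
  have "weight N a (exponents N (\<lambda>i. nat (l i))) = 0 \<longleftrightarrow> (\<forall>k. (\<Sum>i=1..N. l i * (a i $ k - a 0 $ k)) = 0)"
    if "\<forall>i\<in>{1..N}. 0 \<le> l i"
    using that by (simp add: vec_eq_iff weight_component lookup_exponents cong: sum.cong_simp)
  with * show ?thesis by (auto simp: L_plus_def L_lattice_def)
qed

lemma Phi_term_eq:
  fixes lam :: "nat \<Rightarrow> 'k::field_char_0"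
  assumes "\<forall>i\<in>{1..N}. 0 \<le> l i"
  shows "Phi_term N l lam = (-1) ^ nat (\<Sum>i=1..N. l i) * of_nat (multinomial {1..N} (\<lambda>i. nat (l i))) *
    (\<Prod>i=1..N. (lam i / lam 0) ^ nat (l i))"
proof -
  have s: "nat (\<Sum>i=1..N. l i) = (\<Sum>i=1..N. nat (l i))"
  proof -
    have "(\<Sum>i=1..N. l i) = int (\<Sum>i=1..N. nat (l i))"
      using assms by (simp cong: sum.cong_simp)
    then show ?thesis by (metis nat_int)
  qed
  have "0 \<le> (\<Sum>i=1..N. l i)" using assms by (intro sum_nonneg) auto
  moreover have "(\<Prod>i=1..N. (lam i / lam 0) powi l i) = (\<Prod>i=1..N. (lam i / lam 0) ^ nat (l i))"
    using assms by (intro prod.cong) (auto simp: power_int_def)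
  moreover have "(-1 :: 'k) powi (\<Sum>i=1..N. l i) = (-1) ^ nat (\<Sum>i=1..N. l i)"
    using calculation(1) by (simp add: power_int_def)
  ultimately show ?thesis
    unfolding Phi_term_def by (simp only: of_nat_multinomial finite_atLeastAtMost s) simp
qed

text \<open>
  The multinomial theorem in weight zero: by \<open>L_plus_iff\<close>, restricting to positive indices is a bijection
  from the part of \<open>L_plus\<close> of degree \<open>k\<close> onto the exponents of degree \<open>k\<close> and weight zero.
\<close>

lemma ev_weight_zero_part_neg_sum_vars_power:
  fixes a :: "nat \<Rightarrow> int ^ 'n" and lam :: "nat \<Rightarrow> 'k::field_char_0" and N k :: nat
  defines "A \<equiv> {l \<in> L_plus N a. (\<Sum>i=1..N. l i) = int k}"
  shows "finite A" "ev N (\<lambda>i. lam i / lam 0) (weight_zero_part N a (neg_sum_vars N ^ k)) = (\<Sum>l\<in>A. Phi_term N l lam)"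
proof -
  define B where "B = {m \<in> multi_indices {1..N} k. weight N a (exponents N m) = 0}"
  define rel where "rel = (\<lambda>m j. if j \<in> {1..N} then int (m j) else if j = 0 then - int k else undefined)"
  define idx where "idx = (\<lambda>l :: nat \<Rightarrow> int. \<lambda>i\<in>{1..N}. nat (l i))"
  have finB: "finite B" by (simp add: B_def finite_multi_indices)
  have exp_idx: "exponents N (idx l) = exponents N (\<lambda>i. nat (l i))" for l
    by (rule poly_mapping_eqI) (simp add: lookup_exponents idx_def)
  have exp_rel: "exponents N (\<lambda>i. nat (rel m i)) = exponents N m" for m
    by (rule poly_mapping_eqI) (simp add: lookup_exponents rel_def)
  have sum_idx: "int (sum (idx l) {1..N}) = sum l {1..N}" if "l \<in> A" for l
    using that by (auto simp: idx_def A_def L_plus_iff cong: sum.cong_simp)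
  have idx_B: "idx l \<in> B" if "l \<in> A" for l
  proof -
    have "int (sum (idx l) {1..N}) = int k" using sum_idx[OF that] that by (simp only: A_def mem_Collect_eq)
    then have "sum (idx l) {1..N} = k" by (simp only: of_nat_eq_iff)
    moreover have "idx l \<in> {1..N} \<rightarrow>\<^sub>E UNIV" by (simp add: idx_def)
    ultimately show ?thesis
      using that exp_idx[of l] by (simp add: A_def L_plus_iff B_def multi_indices_def)
  qed
  have rel_A: "rel m \<in> A" if "m \<in> B" for m
  proof -
    have "sum (rel m) {1..N} = int k"
      using that by (auto simp: B_def multi_indices_def rel_def cong: sum.cong_simp)
    then show ?thesis using that exp_rel[of m]
      by (auto simp: A_def L_plus_iff B_def PiE_iff extensional_def rel_def)
  qed
  have rel_idx: "rel (idx l) = l" if "l \<in> A" for l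
    using that by (auto simp: A_def L_plus_iff PiE_iff extensional_def rel_def idx_def fun_eq_iff)
  have idx_rel: "idx (rel m) = m" if "m \<in> B" for m
    using that by (auto simp: B_def multi_indices_def PiE_iff extensional_def rel_def idx_def fun_eq_iff)
  have "A \<subseteq> rel ` B" using idx_B rel_idx by (metis image_eqI subsetI)
  then show "finite A" using finB by (metis finite_imageI finite_subset)
  have "ev N (\<lambda>i. lam i / lam 0) (weight_zero_part N a (neg_sum_vars N ^ k)) =
      (\<Sum>m\<in>multi_indices {1..N} k. if weight N a (exponents N m) = 0
         then (-1) ^ k * of_nat (multinomial {1..N} m) * (\<Prod>i=1..N. (lam i / lam 0) ^ m i) else 0)"
    unfolding neg_sum_vars_power weight_zero_part_sum ev_def lin_sum
    by (intro sum.cong) (auto simp: weight_zero_part_single lookup_exponents cong: prod.cong_simp)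
  also have "\<dots> = (\<Sum>m\<in>B. (-1) ^ k * of_nat (multinomial {1..N} m) * (\<Prod>i=1..N. (lam i / lam 0) ^ m i))"
    unfolding B_def by (rule sum.inter_filter[symmetric]) (simp add: finite_multi_indices)
  also have "\<dots> = (\<Sum>l\<in>A. Phi_term N l lam)"
  proof (rule sum.reindex_bij_witness[of _ idx rel])
    fix m assume m: "m \<in> B"
    show "idx (rel m) = m" "rel m \<in> A" using m idx_rel rel_A by auto
    have A: "\<forall>i\<in>{1..N}. 0 \<le> rel m i" "(\<Sum>i=1..N. rel m i) = int k"
      using rel_A[OF m] by (auto simp: A_def L_plus_def)
    have "multinomial {1..N} (\<lambda>i. nat (rel m i)) = multinomial {1..N} m"
      by (rule multinomial_cong) (simp add: rel_def)
    moreover have "(\<Prod>i=1..N. (lam i / lam 0) ^ nat (rel m i)) = (\<Prod>i=1..N. (lam i / lam 0) ^ m i)"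
      by (rule prod.cong) (simp_all add: rel_def)
    ultimately show "Phi_term N (rel m) lam =
        (-1) ^ k * of_nat (multinomial {1..N} m) * (\<Prod>i=1..N. (lam i / lam 0) ^ m i)"
      using A(2) by (simp add: Phi_term_eq[OF A(1)])
  qed (use idx_B rel_idx in auto)
  finally show "ev N (\<lambda>i. lam i / lam 0) (weight_zero_part N a (neg_sum_vars N ^ k)) = (\<Sum>l\<in>A. Phi_term N l lam)" .
qed

lemma ev_Phi_trunc:
  fixes a :: "nat \<Rightarrow> int ^ 'n" and lam :: "nat \<Rightarrow> 'k::field_char_0" and N p s :: nat
  defines "A \<equiv> {l \<in> L_plus N a. (\<Sum>i=1..N. l i) < int (p ^ s)}"
  shows "finite A" "ev N (\<lambda>i. lam i / lam 0) (Phi_trunc p N a s) = (\<Sum>l\<in>A. Phi_term N l lam)"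
proof -
  let ?A = "\<lambda>k. {l \<in> L_plus N a. (\<Sum>i=1..N. l i) = int k}"
  have fin: "finite (?A k)" for k by (rule ev_weight_zero_part_neg_sum_vars_power(1))
  have A: "A = (\<Union>k<p ^ s. ?A k)"
  proof
    show "A \<subseteq> (\<Union>k<p ^ s. ?A k)"
    proof
      fix l assume l: "l \<in> A"
      then have "0 \<le> (\<Sum>i=1..N. l i)" by (intro sum_nonneg) (auto simp: A_def L_plus_def)
      then show "l \<in> (\<Union>k<p ^ s. ?A k)"
        using l by (intro UN_I[of "nat (\<Sum>i=1..N. l i)"]) (auto simp: A_def nat_less_iff)
    qed
  qed (auto simp: A_def simp flip: of_nat_power)
  show "finite A" unfolding A by (rule finite_UN_I) (use fin in auto)
  have "ev N (\<lambda>i. lam i / lam 0) (Phi_trunc p N a s) =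
      (\<Sum>k<p ^ s. ev N (\<lambda>i. lam i / lam 0) (weight_zero_part N a (neg_sum_vars N ^ k)))"
    by (simp add: Phi_trunc_def weight_zero_part_sum ev_def lin_sum)
  also have "\<dots> = (\<Sum>k<p ^ s. \<Sum>l\<in>?A k. Phi_term N l lam)"
    by (simp only: ev_weight_zero_part_neg_sum_vars_power(2))
  also have "\<dots> = (\<Sum>l\<in>A. Phi_term N l lam)"
    unfolding A by (rule sum.UNION_disjoint[symmetric]) (use fin in auto)
  finally show "ev N (\<lambda>i. lam i / lam 0) (Phi_trunc p N a s) = (\<Sum>l\<in>A. Phi_term N l lam)" .
qed

lemma poly_eval_zero: "poly_eval x 0 = 0"
  by (simp add: poly_eval_def)

lemma poly_eval_add: "poly_eval x (P + Q) = poly_eval x P + poly_eval x Q"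
  unfolding poly_eval_def by (rule setsum_keys_plus_distrib) (simp_all add: algebra_simps)

lemma poly_eval_sum: "poly_eval x (sum f A) = (\<Sum>i\<in>A. poly_eval x (f i))"
  by (induction A rule: infinite_finite_induct) (simp_all add: poly_eval_add poly_eval_zero)

lemma poly_eval_single:
  assumes "Poly_Mapping.keys m \<subseteq> {1..N}"
  shows "poly_eval x (Poly_Mapping.single m c) = c * (\<Prod>i=1..N. x i ^ Poly_Mapping.lookup m i)"
proof -
  have "(\<Prod>i\<in>Poly_Mapping.keys m. x i ^ Poly_Mapping.lookup m i) = (\<Prod>i=1..N. x i ^ Poly_Mapping.lookup m i)"
    using assms by (intro prod.mono_neutral_left) (auto simp: in_keys_iff)
  then show ?thesis by (cases "c = 0") (simp_all add: poly_eval_def)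
qed

text \<open>
  Evaluation uses the variables with index in \<open>{1..N}\<close> only, so all others can be dropped from the
  monomials.
\<close>

lemma ev_eq_poly_eval:
  "\<exists>P :: (nat \<Rightarrow>\<^sub>0 nat) \<Rightarrow>\<^sub>0 'k::field. poly_vars_in {1..N} P \<and> (\<forall>x. poly_eval x P = ev N x T)"
proof -
  define e where "e = (\<lambda>m. exponents N (Poly_Mapping.lookup m))"
  define P where "P = (\<Sum>m\<in>Poly_Mapping.keys T. Poly_Mapping.single (e m) (of_int (Poly_Mapping.lookup T m)) :: monomial \<Rightarrow>\<^sub>0 'k)"
  have e: "Poly_Mapping.keys (e m) \<subseteq> {1..N}" for m
    by (auto simp: e_def in_keys_iff lookup_exponents split: if_splits)
  have "Poly_Mapping.keys P \<subseteq> (\<Union>m\<in>Poly_Mapping.keys T. Poly_Mapping.keys (Poly_Mapping.single (e m) (of_int (Poly_Mapping.lookup T m) :: 'k)))"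
    unfolding P_def by (rule keys_sum)
  also have "\<dots> \<subseteq> range e" by auto
  finally have "poly_vars_in {1..N} P" using e by (auto simp: poly_vars_in_def)
  moreover have "poly_eval x P = ev N x T" for x
    unfolding P_def poly_eval_sum poly_eval_single[OF e] ev_def lin_def
    by (simp add: e_def lookup_exponents cong: prod.cong_simp)
  ultimately show ?thesis by blast
qed

section \<open>Convergence in \<open>\<Omega>\<close>\<close>

context
  fixes p :: nat
  assumes H: "is_completed_alg_closure_Qp p TYPE('k::{field_char_0,metric_space})" and p: "prime p"
begin

lemma dist_absv: "dist x y = absv (x - y :: 'k)"
  using H by (simp add: is_completed_alg_closure_Qp_def)

lemma absv_mult: "absv (x * y) = absv x * absv (y :: 'k)"
  using H by (simp add: is_completed_alg_closure_Qp_def)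

lemma absv_add_le_max: "absv (x + y) \<le> max (absv x) (absv (y :: 'k))"
  using H by (simp add: is_completed_alg_closure_Qp_def)

lemma absv_nonneg: "0 \<le> absv (x :: 'k)"
  by (simp add: absv_def)

lemma absv_eq_0_iff: "absv (x :: 'k) = 0 \<longleftrightarrow> x = 0"
  by (simp add: absv_def)

lemma absv_0: "absv (0 :: 'k) = 0"
  by (simp add: absv_def)

lemma absv_1: "absv (1 :: 'k) = 1"
  using absv_mult[of 1 1] absv_eq_0_iff[of 1] by simp

lemma absv_minus: "absv (- x) = absv (x :: 'k)"
  using dist_absv[of 0 x] by (simp add: absv_def dist_commute)

lemma absv_minus_commute: "absv (x - y) = absv (y - x :: 'k)"
  using absv_minus[of "x - y"] by simp

lemma absv_diff_le_max: "absv (x - y) \<le> max (absv x) (absv (y :: 'k))"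
  using absv_add_le_max[of x "- y"] by (simp add: absv_minus)

lemma absv_power: "absv (x ^ n) = absv (x :: 'k) ^ n"
  by (induction n) (simp_all add: absv_1 absv_mult)

lemma absv_prod: "absv (\<Prod>i\<in>A. f i :: 'k) = (\<Prod>i\<in>A. absv (f i))"
  by (induction A rule: infinite_finite_induct) (simp_all add: absv_1 absv_mult)

lemma absv_divide: "absv (x / y) = absv x / absv (y :: 'k)"
proof (cases "y = 0")
  case False
  then have "absv (x / y) * absv y = absv x" by (simp flip: absv_mult)
  then show ?thesis using False by (simp add: field_simps absv_eq_0_iff)
qed (simp add: absv_0)

lemma absv_sum_le:
  assumes "\<And>i. i \<in> A \<Longrightarrow> absv (f i :: 'k) \<le> b" "0 \<le> b"
  shows "absv (\<Sum>i\<in>A. f i) \<le> b"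
  using assms
proof (induction A rule: infinite_finite_induct)
  case (insert i A)
  then show ?case using absv_add_le_max[of "f i" "\<Sum>i\<in>A. f i"] by fastforce
qed (simp_all add: absv_0)

lemma absv_of_int_le_1: "absv (of_int m :: 'k) \<le> 1"
proof (cases "m = 0")
  case False
  then have "absv (of_int m :: 'k) = (1 / real p) ^ multiplicity (int p) m"
    using H by (simp add: is_completed_alg_closure_Qp_def)
  also have "\<dots> \<le> 1" using prime_gt_0_nat[OF p] by (intro power_le_one) auto
  finally show ?thesis .
qed (simp add: absv_0)

lemma absv_of_nat_le_1: "absv (of_nat n :: 'k) \<le> 1"
  using absv_of_int_le_1[of "int n"] by simp

lemma absv_prime: "absv (of_nat p :: 'k) = 1 / real p"
proof -
  have "absv (of_int (int p) :: 'k) = (1 / real p) ^ multiplicity (int p) (int p)"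
    using H prime_gt_0_nat[OF p] by (simp add: is_completed_alg_closure_Qp_def del: of_int_of_nat_eq)
  moreover have "multiplicity (int p) (int p) = 1"
    using p by (intro multiplicity_self) (auto simp: prime_nat_iff)
  ultimately show ?thesis by simp
qed

lemma absv_eq_1_if_close:
  assumes "absv (x :: 'k) = 1" "absv (y - x) < 1"
  shows "absv y = 1"
  using absv_add_le_max[of x "y - x"] absv_diff_le_max[of y "y - x"] assms by auto

lemma ultrametric_limit:
  fixes X :: "nat \<Rightarrow> 'k"
  assumes step: "\<And>s. absv (X (Suc s) - X s) \<le> b s" and "decseq b" "b \<longlonglongrightarrow> 0"
  shows "\<exists>z. \<forall>s. absv (X s - z) \<le> b s"
proof -
  have far: "absv (X (s + n) - X s) \<le> b s" for s n
  proof (induction n)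
    case 0
    show ?case using order_trans[OF absv_nonneg step] by (simp add: absv_0)
  next
    case (Suc n)
    have "absv (X (Suc (s + n)) - X (s + n)) \<le> b s"
      using step[of "s + n"] decseqD[OF \<open>decseq b\<close>, of s "s + n"] by simp
    with Suc absv_add_le_max[of "X (Suc (s + n)) - X (s + n)" "X (s + n) - X s"]
    show ?case by simp
  qed
  have "Cauchy X"
  proof (rule metric_CauchyI)
    fix e :: real assume "0 < e"
    then obtain M where M: "b M < e"
      using order_tendstoD(2)[OF \<open>b \<longlonglongrightarrow> 0\<close>] unfolding eventually_sequentially by blast
    have "dist (X m) (X n) < e" if "M \<le> m" "M \<le> n" for m n
    proof -
      have "absv (X m - X n) \<le> max (absv (X m - X M)) (absv (X n - X M))"
        using absv_diff_le_max[of "X m - X M" "X n - X M"] by simp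
      also have "\<dots> \<le> b M" using far[of M "m - M"] far[of M "n - M"] that by simp
      finally show ?thesis using M by (simp add: dist_absv)
    qed
    then show "\<exists>M. \<forall>m\<ge>M. \<forall>n\<ge>M. dist (X m) (X n) < e" by blast
  qed
  moreover have "complete (UNIV :: 'k set)"
    using H by (simp add: is_completed_alg_closure_Qp_def)
  ultimately obtain z where z: "X \<longlonglongrightarrow> z" by (auto simp: complete_def)
  have "absv (X s - z) \<le> b s" for s
  proof -
    have "(\<lambda>t. dist (X s) (X t)) \<longlonglongrightarrow> dist (X s) z"
      by (intro tendsto_dist tendsto_const z)
    moreover have "\<exists>M. \<forall>t\<ge>M. dist (X s) (X t) \<le> b s"
    proof (intro exI allI impI)
      fix t assume "s \<le> t"
      then show "dist (X s) (X t) \<le> b s"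
        using far[of s "t - s"] by (subst dist_commute) (simp add: dist_absv)
    qed
    ultimately show ?thesis by (metis LIMSEQ_le_const2 dist_absv)
  qed
  then show ?thesis by blast
qed

lemma tendsto_if_absv_le:
  fixes X :: "nat \<Rightarrow> 'k"
  assumes "\<And>s. absv (X s - z) \<le> b s" "b \<longlonglongrightarrow> 0"
  shows "X \<longlonglongrightarrow> z"
proof (rule metric_LIMSEQ_I)
  fix e :: real assume "0 < e"
  then obtain M where "\<forall>s\<ge>M. b s < e"
    using order_tendstoD(2)[OF assms(2)] unfolding eventually_sequentially by blast
  then show "\<exists>M. \<forall>s\<ge>M. dist (X s) z < e"
    using assms(1) by (metis dist_absv order_le_less_trans)
qed

lemma absv_ev_le_1:
  assumes "\<And>i. i \<in> {1..N} \<Longrightarrow> absv (x i :: 'k) \<le> 1"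
  shows "absv (ev N x P) \<le> 1"
  unfolding ev_def lin_def
proof (rule absv_sum_le)
  fix m
  have "absv (\<Prod>i=1..N. x i ^ Poly_Mapping.lookup m i) \<le> 1"
    unfolding absv_prod absv_power
    using assms by (intro prod_le_1) (auto intro: power_le_one absv_nonneg zero_le_power)
  then show "absv (of_int (Poly_Mapping.lookup P m) * (\<Prod>i=1..N. x i ^ Poly_Mapping.lookup m i)) \<le> 1"
    using absv_of_int_le_1 by (simp add: absv_mult mult_le_one absv_nonneg)
qed simp

lemma absv_ev_le_if_dvd:
  assumes "\<And>i. i \<in> {1..N} \<Longrightarrow> absv (x i :: 'k) \<le> 1" "of_nat p ^ s dvd P"
  shows "absv (ev N x P) \<le> (1 / real p) ^ s"
proof -
  obtain Q where "P = of_nat (p ^ s) * Q" using assms(2) by (auto simp: dvd_def)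
  then have "absv (ev N x P) = (1 / real p) ^ s * absv (ev N x Q)"
    by (simp add: ev_of_nat_mult absv_mult absv_power absv_prime del: of_nat_power)
       (simp add: absv_power absv_prime)
  also have "\<dots> \<le> (1 / real p) ^ s"
    using absv_ev_le_1[of N x Q, OF assms(1)] by (intro mult_left_le) auto
  finally show ?thesis .
qed

lemma Phi_trunc_0: "Phi_trunc p N a 0 = 1"
  using weight_zero_part_single[of N a 0 1] by (simp add: Phi_trunc_def weight_def)

text \<open>
  The condition that \<open>\<Phi>\<^sub>1(x)\<close> is a unit is inherited by \<open>x\<^sup>p\<close> because \<open>\<sigma> \<Phi>\<^sub>1 \<equiv> \<Phi>\<^sub>1\<^sup>p\<close> modulo \<open>p\<close>. So induction on \<open>s\<close>
  with \<open>\<Phi>\<^bsub>s+1\<^esub> \<equiv> \<Phi>\<^sub>1 \<cdot> \<sigma> \<Phi>\<^sub>s\<close> modulo \<open>p\<close> applies at both points.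
\<close>

lemma absv_ev_Phi_trunc:
  fixes a :: "nat \<Rightarrow> int ^ 'n"
  assumes int: "{z :: int ^ 'n. real_vec z \<in> interior (Delta N a)} = {a 0}"
    and "\<And>i. i \<in> {1..N} \<Longrightarrow> absv (x i :: 'k) \<le> 1" "absv (ev N x (Phi_trunc p N a 1)) = 1"
  shows "absv (ev N x (Phi_trunc p N a s)) = 1 \<and> absv (ev N x (frob p (Phi_trunc p N a s))) = 1"
proof -
  have small: "absv (ev N y P) < 1"
    if "\<And>i. i \<in> {1..N} \<Longrightarrow> absv (y i :: 'k) \<le> 1" "of_nat p dvd P" for y P
    using absv_ev_le_if_dvd[of N y 1 P] that prime_gt_1_nat[OF p]
    by (simp add: order_le_less_trans)
  have pow: "absv (x i ^ p) \<le> 1" if "absv (x i) \<le> 1" for x :: "nat \<Rightarrow> 'k" and i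
    using that by (simp add: absv_power power_le_one absv_nonneg)
  have step: "absv (ev N (\<lambda>i. y i ^ p) (Phi_trunc p N a 1)) = 1"
    if "\<And>i. i \<in> {1..N} \<Longrightarrow> absv (y i :: 'k) \<le> 1" "absv (ev N y (Phi_trunc p N a 1)) = 1" for y
  proof -
    have "absv (ev N y (Phi_trunc p N a 1) ^ p - ev N y (frob p (Phi_trunc p N a 1))) < 1"
      using small[OF that(1) dvd_frob_diff_power[OF p, of "Phi_trunc p N a 1"]]
      by (simp add: ev_diff ev_power)
    then have "absv (ev N y (frob p (Phi_trunc p N a 1)) - ev N y (Phi_trunc p N a 1) ^ p) < 1"
      using absv_minus by (metis minus_diff_eq)
    then show ?thesis using absv_eq_1_if_close[of "ev N y (Phi_trunc p N a 1) ^ p"] that(2)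
      by (simp add: absv_power ev_frob)
  qed
  have unit: "absv (ev N y (Phi_trunc p N a s)) = 1"
    if "\<And>i. i \<in> {1..N} \<Longrightarrow> absv (y i :: 'k) \<le> 1" "absv (ev N y (Phi_trunc p N a 1)) = 1" for y s
    using that
  proof (induction s arbitrary: y)
    case 0
    show ?case by (simp add: Phi_trunc_0 ev_one absv_1)
  next
    case (Suc s)
    have "absv (ev N (\<lambda>i. y i ^ p) (Phi_trunc p N a s)) = 1"
      using Suc.prems by (intro Suc.IH pow step) auto
    then have "absv (ev N y (Phi_trunc p N a 1) * ev N y (frob p (Phi_trunc p N a s))) = 1"
      using Suc.prems by (simp add: absv_mult ev_frob)
    moreover have "absv (ev N y (Phi_trunc p N a (Suc s)) -
        ev N y (Phi_trunc p N a 1) * ev N y (frob p (Phi_trunc p N a s))) < 1"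
      using small[OF Suc.prems(1) Phi_trunc_cong_first[OF int p, of s]] by (simp add: ev_diff ev_mult)
    ultimately show ?case by (rule absv_eq_1_if_close)
  qed
  show ?thesis
    using unit[OF assms(2,3)] unit[of "\<lambda>i. x i ^ p"] assms(2,3) pow step by (simp add: ev_frob)
qed

lemma absv_Phi_term_le:
  assumes "l \<in> L_plus N a" "\<And>i. i \<in> {1..N} \<Longrightarrow> absv (lam i / lam 0 :: 'k) \<le> r"
  shows "absv (Phi_term N l lam) \<le> r ^ nat (\<Sum>i=1..N. l i)"
proof -
  have l: "\<forall>i\<in>{1..N}. 0 \<le> l i" using assms(1) by (simp add: L_plus_def)
  have "absv (Phi_term N l lam) = absv (of_nat (multinomial {1..N} (\<lambda>i. nat (l i))) :: 'k) *
      (\<Prod>i=1..N. absv (lam i / lam 0) ^ nat (l i))"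
    by (simp add: Phi_term_eq[OF l] absv_mult absv_power absv_minus absv_1 absv_prod)
  also have "\<dots> \<le> 1 * (\<Prod>i=1..N. r ^ nat (l i))"
    using assms(2) by (intro mult_mono prod_mono absv_of_nat_le_1 conjI power_mono prod_nonneg)
      (auto intro: absv_nonneg zero_le_power)
  also have "\<dots> = r ^ (\<Sum>i=1..N. nat (l i))"
    by (simp add: power_sum)
  also have "(\<Sum>i=1..N. nat (l i)) = nat (\<Sum>i=1..N. l i)"
  proof -
    have "(\<Sum>i=1..N. l i) = int (\<Sum>i=1..N. nat (l i))"
      using l by (simp cong: sum.cong_simp)
    then show ?thesis by (metis nat_int)
  qed
  finally show ?thesis .
qed

text \<open>
  The multinomial coefficients are integers, so a term of degree \<open>k\<close> is at most \<open>r ^ k\<close>. By the ultrametric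
  inequality this also bounds every sum of terms of degree at least \<open>k\<close>, which gives both the
  summability and the rate of convergence.
\<close>

lemma absv_ev_Phi_trunc_minus_Phi:
  fixes a :: "nat \<Rightarrow> int ^ 'n"
  assumes r: "\<And>i. i \<in> {1..N} \<Longrightarrow> absv (lam i / lam 0 :: 'k) \<le> r" "0 \<le> r" "r < 1"
  shows "absv (ev N (\<lambda>i. lam i / lam 0) (Phi_trunc p N a s) - Phi N a lam) \<le> r ^ p ^ s"
proof -
  define A where "A = (\<lambda>s. {l \<in> L_plus N a. (\<Sum>i=1..N. l i) < int (p ^ s)})"
  define F where "F = (\<lambda>s. \<Sum>l\<in>A s. Phi_term N l lam)"
  have finA: "finite (A s)" and evF: "ev N (\<lambda>i. lam i / lam 0) (Phi_trunc p N a s) = F s" for s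
    unfolding A_def F_def by (rule ev_Phi_trunc)+
  have p1: "1 < p" using prime_gt_1_nat[OF p] .
  have tail: "absv (\<Sum>l\<in>B. Phi_term N l lam) \<le> r ^ p ^ s" if "B \<subseteq> L_plus N a - A s" for B s
  proof (rule absv_sum_le)
    fix l assume "l \<in> B"
    then have l: "l \<in> L_plus N a" "int (p ^ s) \<le> (\<Sum>i=1..N. l i)" using that by (auto simp: A_def)
    from l(2) have "p ^ s \<le> nat (\<Sum>i=1..N. l i)" by linarith
    then show "absv (Phi_term N l lam) \<le> r ^ p ^ s"
      using absv_Phi_term_le[of l N a lam r, OF l(1) r(1)] power_decreasing[of "p ^ s" _ r] r(2,3)
      by (meson less_imp_le order_trans)
  qed (use r in simp)
  have lim0: "(\<lambda>s. r ^ p ^ s) \<longlonglongrightarrow> 0" 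
    using LIMSEQ_subseq_LIMSEQ[of "\<lambda>n. r ^ n" 0 "\<lambda>s. p ^ s"] r p1
    by (simp add: LIMSEQ_power_zero strict_mono_def power_strict_increasing o_def)
  have mono: "A s \<subseteq> A (Suc s)" for s
    using p1 by (auto simp: A_def intro: less_le_trans)
  have "absv (F (Suc s) - F s) \<le> r ^ p ^ s" for s
  proof -
    have "F (Suc s) - F s = (\<Sum>l\<in>A (Suc s) - A s. Phi_term N l lam)"
      unfolding F_def by (simp add: sum_diff finA mono)
    then show ?thesis using tail[of "A (Suc s) - A s" s] by (auto simp: A_def)
  qed
  moreover have "decseq (\<lambda>s. r ^ p ^ s)"
    unfolding decseq_def using r(2,3) p1 by (intro allI impI power_decreasing power_increasing) auto
  ultimately obtain z where z: "\<And>s. absv (F s - z) \<le> r ^ p ^ s"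
    using ultrametric_limit[of F "\<lambda>s. r ^ p ^ s", OF _ _ lim0] by blast
  have "((\<lambda>l. Phi_term N l lam) has_sum z) (L_plus N a)"
    unfolding has_sum_def
  proof (rule tendstoI)
    fix e :: real assume "0 < e"
    then obtain s where s: "r ^ p ^ s < e"
      using order_tendstoD(2)[OF lim0] unfolding eventually_sequentially by blast
    have "dist (\<Sum>l\<in>Y. Phi_term N l lam) z < e" if Y: "finite Y" "A s \<subseteq> Y" "Y \<subseteq> L_plus N a" for Y
    proof -
      have "(\<Sum>l\<in>Y. Phi_term N l lam) - F s = (\<Sum>l\<in>Y - A s. Phi_term N l lam)"
        unfolding F_def using Y by (simp add: sum_diff)
      then have "absv ((\<Sum>l\<in>Y. Phi_term N l lam) - F s) \<le> r ^ p ^ s"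
        using tail[of "Y - A s" s] Y by auto
      with z[of s] absv_add_le_max[of "(\<Sum>l\<in>Y. Phi_term N l lam) - F s" "F s - z"] s
      show ?thesis by (simp add: dist_absv)
    qed
    then show "\<forall>\<^sub>F Y in finite_subsets_at_top (L_plus N a). dist (\<Sum>l\<in>Y. Phi_term N l lam) z < e"
      unfolding eventually_finite_subsets_at_top
      by (intro exI[of _ "A s"]) (use finA[of s] in \<open>auto simp: A_def\<close>)
  qed
  then have "Phi N a lam = z" unfolding Phi_def by (rule infsumI)
  then show ?thesis using z[of s] by (simp add: evF)
qed

text \<open>
  The extension is the limit of \<open>\<Phi>\<^bsub>s+1\<^esub>(x) / \<Phi>\<^sub>s(x\<^sup>p)\<close>. The difference of consecutive ratios has a unit
  denominator, and its numerator is the one in \<open>dwork_congruence\<close>.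
\<close>

lemma Phi_ratio_extends:
  fixes a :: "nat \<Rightarrow> int ^ 'n"
  assumes int: "{z :: int ^ 'n. real_vec z \<in> interior (Delta N a)} = {a 0}"
  shows "\<exists>f :: (nat \<Rightarrow> 'k) \<Rightarrow> 'k.
    analytic_fun_on N (D_plus p N a) f \<and>
    (\<forall>lam \<in> D_set N. f lam = Phi N a lam / Phi N a (pow_tuple N p lam))"
proof -
  define x where "x = (\<lambda>(lam :: nat \<Rightarrow> 'k) i. lam i / lam 0)"
  define F where "F = (\<lambda>s lam. ev N (x lam) (Phi_trunc p N a s))"
  define F' where "F' = (\<lambda>s lam. ev N (x lam) (frob p (Phi_trunc p N a s)))"
  define R where "R = (\<lambda>s lam. F (Suc s) lam / F' s lam)"
  have p1: "1 < p" using prime_gt_1_nat[OF p] .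
  have Phi1: "Phi1 p N a lam = F 1 lam" for lam
  proof -
    have "{l. l \<in> L_plus N a \<and> (\<Sum>i=1..N. l i) \<le> int p - 1} =
        {l \<in> L_plus N a. (\<Sum>i=1..N. l i) < int (p ^ 1)}" by auto
    then show ?thesis by (simp only: Phi1_def F_def x_def ev_Phi_trunc(2))
  qed
  have int_D: "absv (x lam i) \<le> 1" if "lam \<in> D_plus p N a" "i \<in> {1..N}" for lam i
    using that by (auto simp: D_plus_def x_def)
  have unit: "absv (F s lam) = 1" "absv (F' s lam) = 1" if "lam \<in> D_plus p N a" for lam s
    using absv_ev_Phi_trunc[OF int int_D[OF that]] that Phi1[of lam]
    by (auto simp: D_plus_def F_def F'_def)
  have F'_0: "F' s lam \<noteq> 0" if "lam \<in> D_plus p N a" for lam s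
    using unit(2)[OF that, of s] absv_0 by auto
  have step: "absv (R (Suc s) lam - R s lam) \<le> (1 / real p) ^ s" if lam: "lam \<in> D_plus p N a" for lam s
  proof -
    have "R (Suc s) lam - R s lam =
        (F (Suc (Suc s)) lam * F' s lam - F (Suc s) lam * F' (Suc s) lam) / (F' (Suc s) lam * F' s lam)"
      using F'_0[OF lam] by (simp add: R_def field_simps)
    then have "absv (R (Suc s) lam - R s lam) =
        absv (F (Suc (Suc s)) lam * F' s lam - F (Suc s) lam * F' (Suc s) lam)"
      using unit[OF lam] by (simp add: absv_divide absv_mult)
    also have "\<dots> = absv (F (Suc s) lam * F' (Suc s) lam - F (Suc (Suc s)) lam * F' s lam)"
      by (rule absv_minus_commute)
    also have "\<dots> \<le> (1 / real p) ^ Suc s"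
      using absv_ev_le_if_dvd[OF int_D[OF lam] dwork_congruence[OF int p, of "Suc s"]]
      by (simp add: ev_diff ev_mult F_def F'_def)
    also have "\<dots> \<le> (1 / real p) ^ s"
      using p1 by (intro power_decreasing) auto
    finally show ?thesis .
  qed
  have lim0: "(\<lambda>s. (1 / real p) ^ s) \<longlonglongrightarrow> 0"
    using p1 by (intro LIMSEQ_power_zero) simp
  have "\<exists>z. \<forall>s. absv (R s lam - z) \<le> (1 / real p) ^ s" if "lam \<in> D_plus p N a" for lam
    using p1 by (intro ultrametric_limit step that lim0)
      (auto simp: decseq_def intro!: power_decreasing)
  then obtain f where f: "\<And>lam s. lam \<in> D_plus p N a \<Longrightarrow> absv (R s lam - f lam) \<le> (1 / real p) ^ s"
    by metis
  have "rational_on N (D_plus p N a) (R s)" for s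
  proof -
    obtain P Q :: "(nat \<Rightarrow>\<^sub>0 nat) \<Rightarrow>\<^sub>0 'k" where
      "poly_vars_in {1..N} P" "\<And>y. poly_eval y P = ev N y (Phi_trunc p N a (Suc s))"
      "poly_vars_in {1..N} Q" "\<And>y. poly_eval y Q = ev N y (frob p (Phi_trunc p N a s))"
      using ev_eq_poly_eval by metis
    then show ?thesis unfolding rational_on_def
      using F'_0[of _ s] by (intro exI[of _ P] exI[of _ Q]) (auto simp: R_def F_def F'_def x_def)
  qed
  moreover have "uniform_limit (D_plus p N a) R f sequentially"
  proof (rule uniform_limitI)
    fix e :: real assume "0 < e"
    from order_tendstoD(2)[OF lim0 this]
    show "\<forall>\<^sub>F s in sequentially. \<forall>lam\<in>D_plus p N a. dist (R s lam) (f lam) < e"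
      by eventually_elim (use f in \<open>auto simp: dist_absv intro: order_le_less_trans\<close>)
  qed
  ultimately have "analytic_fun_on N (D_plus p N a) f"
    unfolding analytic_fun_on_def by blast
  moreover have "f lam = Phi N a lam / Phi N a (pow_tuple N p lam)" if lam: "lam \<in> D_set N" for lam
  proof -
    \<comment> \<open>zero is inserted because \<open>N\<close> may be \<open>0\<close>\<close>
    define r where "r = Max (insert 0 ((\<lambda>i. absv (x lam i)) ` {1..N}))"
    have r: "absv (x lam i) \<le> r" if "i \<in> {1..N}" for i
      unfolding r_def using that by (intro Max_ge) auto
    have r01: "0 \<le> r" "r < 1"
      unfolding r_def using lam by (auto simp: D_set_def x_def intro: Max_ge)
    have x_pow: "pow_tuple N p lam i / pow_tuple N p lam 0 = x lam i ^ p" if "i \<in> {1..N}" for i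
      using that by (simp add: pow_tuple_def x_def power_divide)
    have r_pow: "absv (pow_tuple N p lam i / pow_tuple N p lam 0) \<le> r" if "i \<in> {1..N}" for i
    proof -
      have "absv (x lam i) ^ p \<le> absv (x lam i)"
        using power_decreasing[of 1 p "absv (x lam i)"] p1 r[OF that] r01 by (simp add: absv_nonneg)
      then show ?thesis using r[OF that] by (simp add: x_pow[OF that] absv_power)
    qed
    have F: "absv (F s lam - Phi N a lam) \<le> r ^ p ^ s" for s
      unfolding F_def x_def
      by (rule absv_ev_Phi_trunc_minus_Phi) (use r r01 in \<open>auto simp: x_def\<close>)
    have "F' s lam = ev N (\<lambda>i. pow_tuple N p lam i / pow_tuple N p lam 0) (Phi_trunc p N a s)" for s
      unfolding F'_def ev_frob by (rule ev_cong) (simp add: x_pow)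
    then have F': "absv (F' s lam - Phi N a (pow_tuple N p lam)) \<le> r ^ p ^ s" for s
      by (simp only:) (rule absv_ev_Phi_trunc_minus_Phi[OF _ r01], rule r_pow)
    have one: "F 0 lam = 1" "F' 0 lam = 1" by (simp_all add: F_def F'_def Phi_trunc_0 ev_one)
    \<comment> \<open>at \<open>s = 0\<close> the truncation is \<open>1\<close> and the error is at most \<open>r < 1\<close>\<close>
    have Phi_unit: "absv (Phi N a lam) = 1"
      by (rule absv_eq_1_if_close[of 1])
        (use F[of 0] r01 in \<open>auto simp: one absv_1 dist_absv[symmetric] dist_commute\<close>)
    have Phi_unit': "absv (Phi N a (pow_tuple N p lam)) = 1"
      by (rule absv_eq_1_if_close[of 1])
        (use F'[of 0] r01 in \<open>auto simp: one absv_1 dist_absv[symmetric] dist_commute\<close>)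
    have "r ^ p < 1" using r01 p1 by (intro power_less_one_iff[THEN iffD2]) auto
    then have "absv (F 1 lam) = 1"
      using absv_eq_1_if_close[OF Phi_unit, of "F 1 lam"] F[of 1] by simp
    then have lam': "lam \<in> D_plus p N a"
      using lam r r01 by (auto simp: D_plus_def D_set_def Phi1 less_imp_le)
    have "absv (R s lam - Phi N a lam / Phi N a (pow_tuple N p lam)) \<le> r ^ p ^ s" for s
    proof -
      let ?P = "Phi N a lam" and ?P' = "Phi N a (pow_tuple N p lam)"
      have P'0: "?P' \<noteq> 0" using Phi_unit' absv_0 by auto
      have "R s lam - ?P / ?P' = ((F (Suc s) lam - ?P) * ?P' - ?P * (F' s lam - ?P')) / (F' s lam * ?P')"
        using F'_0[OF lam', of s] P'0 by (simp add: R_def field_simps)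
      then have "absv (R s lam - ?P / ?P') = absv ((F (Suc s) lam - ?P) * ?P' - ?P * (F' s lam - ?P'))"
        by (simp add: absv_divide absv_mult unit[OF lam'] Phi_unit')
      also have "\<dots> \<le> max (absv (F (Suc s) lam - ?P)) (absv (F' s lam - ?P'))"
        using absv_diff_le_max[of "(F (Suc s) lam - ?P) * ?P'" "?P * (F' s lam - ?P')"]
        by (simp add: absv_mult Phi_unit Phi_unit')
      also have "\<dots> \<le> r ^ p ^ s"
      proof -
        have "r ^ p ^ Suc s \<le> r ^ p ^ s"
          using r01 p1 by (intro power_decreasing power_increasing) auto
        then show ?thesis using F[of "Suc s"] F'[of s] by simp
      qed
      finally show ?thesis .
    qed
    moreover have "(\<lambda>s. r ^ p ^ s) \<longlonglongrightarrow> 0" 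
      using LIMSEQ_subseq_LIMSEQ[of "\<lambda>n. r ^ n" 0 "\<lambda>s. p ^ s"] r01 p1
      by (simp add: LIMSEQ_power_zero strict_mono_def power_strict_increasing o_def)
    ultimately have "(\<lambda>s. R s lam) \<longlonglongrightarrow> Phi N a lam / Phi N a (pow_tuple N p lam)"
      by (rule tendsto_if_absv_le)
    moreover have "(\<lambda>s. R s lam) \<longlonglongrightarrow> f lam"
      by (rule tendsto_if_absv_le[OF f[OF lam'] lim0])
    ultimately show ?thesis by (rule LIMSEQ_unique[rotated])
  qed
  ultimately show ?thesis by blast
qed

end

theorem theorem1p4:
  fixes N :: nat and a :: "nat \<Rightarrow> int ^ 'n" and p :: nat
  assumes "{z :: int ^ 'n. real_vec z \<in> interior (Delta N a)} = {a 0}"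
    and "prime p" and "p \<noteq> 2"
    and "is_completed_alg_closure_Qp p TYPE('k::{field_char_0,metric_space})"
  shows "\<exists>f :: (nat \<Rightarrow> 'k) \<Rightarrow> 'k.
    analytic_fun_on N (D_plus p N a) f \<and>
    (\<forall>lam \<in> D_set N. f lam = Phi N a lam / Phi N a (pow_tuple N p lam))"
  using Phi_ratio_extends[OF assms(4,2,1)] .

end
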